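(* Let $\Delta$ be a finite flag simplicial complex with vertices $v_1,\dots,v_k$, let $A$ be the right-angled Artin group with presentation $\langle a_1,\dots,a_k \mid [a_i,a_j] \text{ whenever } v_i \text{ and } v_j \text{ are joined by an edge of } \Delta\rangle$, and let $H_\Delta$ be the kernel of the homomorphism $A\to\mathbb{Z}=\langle t\rangle$ sending every $a_i$ to $t$. If $\Delta$ is simply connected, then the Dehn function $\delta$ of $H_\Delta$ satisfies $\delta(n)\preceq n^4$.
   Context: When $\Delta$ is simply connected, $H_\Delta$ is known to be finitely presented. For a presentation $\mathcal{P}=\langle \mathcal{A}\mid\mathcal{R}\rangle$ with $\mathcal{A}$ finite, the $\mathcal{P}$-area of a word $w$ over $\mathcal{A}^{\pm1}$ representing the identity is the least $m$ such that $w$ is freely equal to $\prod_{i=1}^m x_i r_i x_i^{-1}$ with $x_i$ words and $r_i\in\mathcal{R}^{\pm1}$; the Dehn function $\delta_{\mathcal{P}}(n)$ is the maximum $\mathcal{P}$-area of such words of length at most $n$. For $f,g:\mathbb{N}\to\mathbb{N}$, $f\preceq g$ means there is $C>0$ with $f(n)\le Cg(Cn+C)+Cn+C$ for all $n$; $f\simeq g$ means $f\preceq g$ and $g\preceq f$. The Dehn function of a finitely presented group is $\delta_{\mathcal{P}}$ for any finite presentation $\mathcal{P}$, well defined up to $\simeq$. *)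

theory Defs
  imports "HOL-Analysis.Analysis"
begin

text \<open>A finite flag simplicial complex is the clique complex of its 1-skeleton, a finite
simple graph. The vertex set is the finite type 'v, the edge relation is E. The simplices
are the nonempty cliques of E; the geometric realization places vertex v at the standard
basis vector axis v 1 of real^'v and takes the union of the convex hulls of the simplices.\<close>

definition is_simplex :: "('v \<Rightarrow> 'v \<Rightarrow> bool) \<Rightarrow> 'v set \<Rightarrow> bool" where
  "is_simplex E \<sigma> \<longleftrightarrow> \<sigma> \<noteq> {} \<and> finite \<sigma> \<and> (\<forall>x\<in>\<sigma>. \<forall>y\<in>\<sigma>. x \<noteq> y \<longrightarrow> E x y)"

definition flag_realization :: "('v::finite \<Rightarrow> 'v \<Rightarrow> bool) \<Rightarrow> (real^'v) set" where
  "flag_realization E = \<Union>{convex hull ((\<lambda>v. axis v 1) ` \<sigma>) | \<sigma>. is_simplex E \<sigma>}"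

text \<open>A word over an alphabet is a list of letters (a, e); e = False means a, e = True means a^-1.\<close>

type_synonym 'a word = "('a \<times> bool) list"

definition word_over :: "'a set \<Rightarrow> 'a word \<Rightarrow> bool" where
  "word_over A w \<longleftrightarrow> fst ` set w \<subseteq> A"

definition winv :: "'a word \<Rightarrow> 'a word" where
  "winv w = rev (map (\<lambda>(a, e). (a, \<not> e)) w)"

definition red1 :: "'a word \<Rightarrow> 'a word \<Rightarrow> bool" where
  "red1 w w' \<longleftrightarrow> (\<exists>u v a e. w = u @ [(a, e), (a, \<not> e)] @ v \<and> w' = u @ v)"

definition free_eq :: "'a word \<Rightarrow> 'a word \<Rightarrow> bool" where
  "free_eq u v \<longleftrightarrow> (\<lambda>x y. red1 x y \<or> red1 y x)\<^sup>*\<^sup>* u v"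

definition conj_prod :: "'a set \<Rightarrow> 'a word set \<Rightarrow> ('a word \<times> 'a word) list \<Rightarrow> bool" where
  "conj_prod A R ps \<longleftrightarrow> (\<forall>(x, r)\<in>set ps. word_over A x \<and> (r \<in> R \<or> winv r \<in> R))"

definition prod_conj :: "('a word \<times> 'a word) list \<Rightarrow> 'a word" where
  "prod_conj ps = concat (map (\<lambda>(x, r). x @ r @ winv x) ps)"

definition null_word :: "'a set \<Rightarrow> 'a word set \<Rightarrow> 'a word \<Rightarrow> bool" where
  "null_word A R w \<longleftrightarrow> (\<exists>ps. conj_prod A R ps \<and> free_eq w (prod_conj ps))"

definition area :: "'a set \<Rightarrow> 'a word set \<Rightarrow> 'a word \<Rightarrow> nat" where
  "area A R w = (LEAST m. \<exists>ps. length ps = m \<and> conj_prod A R ps \<and> free_eq w (prod_conj ps))"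

definition dehn :: "'a set \<Rightarrow> 'a word set \<Rightarrow> nat \<Rightarrow> nat" where
  "dehn A R n = Max (area A R ` {w. word_over A w \<and> length w \<le> n \<and> null_word A R w})"

definition dehn_le :: "(nat \<Rightarrow> nat) \<Rightarrow> (nat \<Rightarrow> nat) \<Rightarrow> bool" where
  "dehn_le f g \<longleftrightarrow> (\<exists>C>0. \<forall>n. f n \<le> C * g (C * n + C) + C * n + C)"

definition raag_rels :: "('v \<Rightarrow> 'v \<Rightarrow> bool) \<Rightarrow> 'v word set" where
  "raag_rels E = {[(a, False), (b, False), (a, True), (b, True)] | a b. E a b}"

definition raag_eq :: "('v \<Rightarrow> 'v \<Rightarrow> bool) \<Rightarrow> 'v word \<Rightarrow> 'v word \<Rightarrow> bool" where
  "raag_eq E u v \<longleftrightarrow> null_word UNIV (raag_rels E) (u @ winv v)"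

text \<open>Image of a word under A_\<Delta> \<rightarrow> Z, a_i \<mapsto> t (exponent sum); H_\<Delta> is the set of
elements represented by words with exponent sum 0.\<close>
definition expsum :: "'v word \<Rightarrow> int" where
  "expsum w = (\<Sum>(a, e)\<leftarrow>w. if e then -1 else 1)"

definition eval_word :: "('b \<Rightarrow> 'v word) \<Rightarrow> 'b word \<Rightarrow> 'v word" where
  "eval_word \<phi> w = concat (map (\<lambda>(b, e). if e then winv (\<phi> b) else \<phi> b) w)"

text \<open>(A, R) is a finite presentation of H_\<Delta> via the generator map \<phi>: the induced
homomorphism from <A|R> to H_\<Delta> is well defined, surjective and injective.\<close>
definition is_fin_pres_H :: "('v \<Rightarrow> 'v \<Rightarrow> bool) \<Rightarrow> 'b set \<Rightarrow> 'b word set \<Rightarrow> ('b \<Rightarrow> 'v word) \<Rightarrow> bool" where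
  "is_fin_pres_H E A R \<phi> \<longleftrightarrow>
     finite A \<and> finite R \<and> (\<forall>r\<in>R. word_over A r) \<and>
     (\<forall>b\<in>A. expsum (\<phi> b) = 0) \<and>
     (\<forall>u. expsum u = 0 \<longrightarrow> (\<exists>w. word_over A w \<and> raag_eq E (eval_word \<phi> w) u)) \<and>
     (\<forall>w. word_over A w \<longrightarrow> (raag_eq E (eval_word \<phi> w) [] \<longleftrightarrow> null_word A R w))"

end

theory Submission
  imports Defs
begin

text \<open>
  The proof pushes fillings from the right-angled Artin group \<open>A\<close> into the kernel. Fix a base
  vertex \<open>o\<close>. For an edge \<open>ab\<close> the element \<open>a b\<^sup>-\<^sup>1\<close> lies in the kernel, and since \<open>a\<close> and \<open>b\<close>
  commute, its \<open>k\<close>-th power is \<open>a\<^sup>k b\<^sup>-\<^sup>k\<close>. Multiplying such powers along an edge path from \<open>o\<close> to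
  \<open>v\<close> represents \<open>o\<^sup>k v\<^sup>-\<^sup>k\<close>. Across a triangle these power words satisfy the multiplication law
  at the cost of \<open>O(k\<^sup>2)\<close> relators, and by simple connectivity any two edge paths with the same
  ends differ by finitely many triangle moves, so changing the path also costs \<open>O(k\<^sup>2)\<close>.

  A null word of length \<open>n\<close> in \<open>A\<close> contains a pair \<open>a\<^sup>e u a\<^sup>-\<^sup>e\<close> in which every letter of \<open>u\<close>
  commutes with \<open>a\<close>, so it is filled by at most \<open>n\<^sup>2\<close> commutations, all at heights (exponent sums
  of prefixes) at most \<open>n\<close>. Pushed into the kernel, a commutation at height \<open>h\<close> costs \<open>O(h\<^sup>2)\<close>
  relators, which gives \<open>O(n\<^sup>4)\<close> in total.
\<close>

section \<open>Words and counted relators\<close>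

lemma winv_Nil [simp]: "winv [] = []"
  by (simp add: winv_def)

lemma winv_append [simp]: "winv (u @ v) = winv v @ winv u"
  by (simp add: winv_def)

lemma winv_Cons: "winv ((a, e) # w) = winv w @ [(a, \<not> e)]"
  by (simp add: winv_def)

lemma winv_winv [simp]: "winv (winv w) = w"
  by (simp add: winv_def rev_map comp_def case_prod_unfold)

lemma length_winv [simp]: "length (winv w) = length w"
  by (simp add: winv_def)

lemma word_over_Nil [simp]: "word_over A []"
  by (simp add: word_over_def)

lemma word_over_append [simp]: "word_over A (u @ v) \<longleftrightarrow> word_over A u \<and> word_over A v"
  by (auto simp: word_over_def)

lemma word_over_Cons [simp]: "word_over A (l # v) \<longleftrightarrow> fst l \<in> A \<and> word_over A v"
  by (auto simp: word_over_def)

lemma word_over_winv [simp]: "word_over A (winv w) \<longleftrightarrow> word_over A w"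
  by (auto simp: word_over_def winv_def image_iff split: prod.splits; force)

lemma free_eq_refl [simp]: "free_eq u u"
  by (simp add: free_eq_def)

lemma free_eq_trans [trans]: "free_eq u v \<Longrightarrow> free_eq v w \<Longrightarrow> free_eq u w"
  unfolding free_eq_def by (rule rtranclp_trans)

lemma free_eq_sym: "free_eq u v \<Longrightarrow> free_eq v u"
  unfolding free_eq_def by (rule sympD[OF symp_rtranclp]) (auto simp: symp_def)

lemma red1_context: "red1 u v \<Longrightarrow> red1 (p @ u @ q) (p @ v @ q)"
  unfolding red1_def by (metis append.assoc)

lemma free_eq_context: "free_eq u v \<Longrightarrow> free_eq (p @ u @ q) (p @ v @ q)"
  unfolding free_eq_def
proof (induction rule: rtranclp_induct)
  case (step y z)
  then have "red1 (p @ y @ q) (p @ z @ q) \<or> red1 (p @ z @ q) (p @ y @ q)"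
    using red1_context by blast
  with step.IH show ?case by (rule rtranclp.rtrancl_into_rtrancl)
qed simp

lemma free_eq_append: "free_eq u v \<Longrightarrow> free_eq u' v' \<Longrightarrow> free_eq (u @ u') (v @ v')"
  using free_eq_context[of u v "[]" u'] free_eq_context[of u' v' v "[]"]
  by (auto intro: free_eq_trans)

lemma free_eq_cancel_letter: "free_eq [(a, e), (a, \<not> e)] []"
  unfolding free_eq_def red1_def by (intro r_into_rtranclp) force

lemma free_eq_cancel: "free_eq (u @ winv u) []"
proof (induction u)
  case (Cons l u)
  obtain a e where l: "l = (a, e)" by force
  have "free_eq ([(a, e)] @ (u @ winv u) @ [(a, \<not> e)]) ([(a, e)] @ [] @ [(a, \<not> e)])"
    by (rule free_eq_context) (rule Cons)
  then show ?case
    using free_eq_trans[OF _ free_eq_cancel_letter] by (simp add: l winv_Cons)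
qed simp

lemma free_eq_cancel': "free_eq (winv u @ u) []"
  using free_eq_cancel[of "winv u"] by simp

lemma free_eq_cancel_mid: "free_eq (p @ u @ winv u @ q) (p @ q)"
  using free_eq_context[OF free_eq_cancel, of p u q] by simp

lemma free_eq_cancel_mid': "free_eq (p @ winv u @ u @ q) (p @ q)"
  using free_eq_cancel_mid[of p "winv u" q] by simp

section \<open>Products of conjugated relators and counted equality\<close>

lemma prod_conj_append [simp]: "prod_conj (ps @ qs) = prod_conj ps @ prod_conj qs"
  by (simp add: prod_conj_def)

lemma conj_prod_append [simp]: "conj_prod A R (ps @ qs) \<longleftrightarrow> conj_prod A R ps \<and> conj_prod A R qs"
  by (auto simp: conj_prod_def)

lemma winv_prod_conj: "winv (prod_conj ps) = prod_conj (rev (map (\<lambda>(x, r). (x, winv r)) ps))"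
  by (induction ps) (auto simp: prod_conj_def)

lemma conj_prod_inv: "conj_prod A R ps \<Longrightarrow> conj_prod A R (rev (map (\<lambda>(x, r). (x, winv r)) ps))"
  by (auto simp: conj_prod_def)

text \<open>Conjugating every factor by \<open>v\<close> makes the inner copies of
  \<open>winv v\<close> and \<open>v\<close> cancel, so conjugation does not change the number of
  relators.\<close>

lemma prod_conj_shift: "free_eq (prod_conj (map (\<lambda>(x, r). (v @ x, r)) ps)) (v @ prod_conj ps @ winv v)"
proof (induction ps)
  case Nil
  show ?case by (simp add: prod_conj_def free_eq_sym[OF free_eq_cancel])
next
  case (Cons p ps)
  obtain x r where p: "p = (x, r)" by force
  have "free_eq (prod_conj (map (\<lambda>(x, r). (v @ x, r)) (p # ps)))
          ((v @ x @ r @ winv x @ winv v) @ (v @ prod_conj ps @ winv v))"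
    using free_eq_append[OF free_eq_refl[of "v @ x @ r @ winv x @ winv v"] Cons]
    by (simp add: p prod_conj_def)
  also have "free_eq \<dots> (v @ prod_conj (p # ps) @ winv v)"
    using free_eq_cancel_mid'[of "v @ x @ r @ winv x" v "prod_conj ps @ winv v"]
    by (simp add: p prod_conj_def)
  finally show ?case .
qed

text \<open>Equality in the presented group with a budget of \<open>k\<close> relators. Keeping the
  relators on the left makes transitivity a concatenation of lists; an upper bound instead of an
  exact count allows weakening.\<close>

definition aeq :: "'a set \<Rightarrow> 'a word set \<Rightarrow> nat \<Rightarrow> 'a word \<Rightarrow> 'a word \<Rightarrow> bool" where
  "aeq A R k u v \<longleftrightarrow> word_over A u \<and> word_over A v \<and>
     (\<exists>ps. conj_prod A R ps \<and> length ps \<le> k \<and> free_eq u (prod_conj ps @ v))"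

lemma aeq_over1: "aeq A R k u v \<Longrightarrow> word_over A u" and aeq_over2: "aeq A R k u v \<Longrightarrow> word_over A v"
  by (auto simp: aeq_def)

lemma aeq_free: "word_over A u \<Longrightarrow> word_over A v \<Longrightarrow> free_eq u v \<Longrightarrow> aeq A R k u v"
  unfolding aeq_def by (auto intro!: exI[of _ "[]"] simp: conj_prod_def prod_conj_def)

lemma aeq_refl: "word_over A u \<Longrightarrow> aeq A R k u u"
  by (rule aeq_free) auto

lemma aeq_mono: "aeq A R k u v \<Longrightarrow> k \<le> l \<Longrightarrow> aeq A R l u v"
  unfolding aeq_def using order.trans by blast

lemma aeq_trans:
  assumes "aeq A R k u v" "aeq A R l v w"
  shows "aeq A R (k + l) u w"
proof -
  from assms obtain ps qs where ps: "conj_prod A R ps" "length ps \<le> k" "free_eq u (prod_conj ps @ v)"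
    and qs: "conj_prod A R qs" "length qs \<le> l" "free_eq v (prod_conj qs @ w)"
    unfolding aeq_def by blast
  have "free_eq u (prod_conj (ps @ qs) @ w)"
    using free_eq_trans[OF ps(3) free_eq_append[OF free_eq_refl qs(3)]] by simp
  with ps qs assms show ?thesis
    unfolding aeq_def by (auto intro!: exI[of _ "ps @ qs"])
qed

lemma aeq_trans_free: "aeq A R k u v \<Longrightarrow> free_eq v w \<Longrightarrow> word_over A w \<Longrightarrow> aeq A R k u w"
  using aeq_trans[of A R k u v 0 w] aeq_free[of A v w R 0] aeq_over2[of A R k u v] by simp

lemma aeq_free_trans: "free_eq u v \<Longrightarrow> aeq A R k v w \<Longrightarrow> word_over A u \<Longrightarrow> aeq A R k u w"
  using aeq_trans[of A R 0 u v k w] aeq_free[of A u v R 0] aeq_over1[of A R k v w] by simp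

lemma aeq_sym:
  assumes "aeq A R k u v"
  shows "aeq A R k v u"
proof -
  from assms obtain ps where ps: "conj_prod A R ps" "length ps \<le> k" "free_eq u (prod_conj ps @ v)"
    unfolding aeq_def by blast
  have "free_eq (winv (prod_conj ps) @ u) (winv (prod_conj ps) @ prod_conj ps @ v)"
    by (rule free_eq_append[OF free_eq_refl ps(3)])
  also have "free_eq \<dots> v"
    using free_eq_cancel_mid'[of "[]" "prod_conj ps" v] by simp
  finally have "free_eq v (winv (prod_conj ps) @ u)" by (rule free_eq_sym)
  then show ?thesis
    using assms ps(2) conj_prod_inv[OF ps(1)] unfolding aeq_def winv_prod_conj
    by (metis length_map length_rev)
qed

text \<open>The relators used for \<open>u'\<close> stand to the right of \<open>v\<close>;
  conjugating them by \<open>v\<close> moves them to the left at no extra cost, so the budgets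
  simply add.\<close>

lemma aeq_append:
  assumes "aeq A R k u v" "aeq A R l u' v'"
  shows "aeq A R (k + l) (u @ u') (v @ v')"
proof -
  from assms obtain ps qs where ps: "conj_prod A R ps" "length ps \<le> k" "free_eq u (prod_conj ps @ v)"
    and qs: "conj_prod A R qs" "length qs \<le> l" "free_eq u' (prod_conj qs @ v')"
    unfolding aeq_def by blast
  have over: "word_over A v" using assms(1) by (rule aeq_over2)
  let ?qs = "map (\<lambda>(x, r). (v @ x, r)) qs"
  have "free_eq (u @ u') ((prod_conj ps @ v) @ (prod_conj qs @ v'))"
    by (rule free_eq_append[OF ps(3) qs(3)])
  also have "free_eq \<dots> (prod_conj ps @ (v @ prod_conj qs @ winv v) @ v @ v')"
    using free_eq_sym[OF free_eq_cancel_mid'[of "prod_conj ps @ v @ prod_conj qs" v v']] by simp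
  also have "free_eq \<dots> (prod_conj ps @ prod_conj ?qs @ v @ v')"
    by (rule free_eq_context[OF free_eq_sym[OF prod_conj_shift]])
  finally have "free_eq (u @ u') (prod_conj (ps @ ?qs) @ v @ v')" by simp
  moreover have "conj_prod A R (ps @ ?qs)"
    using ps(1) qs(1) over by (auto simp: conj_prod_def)
  ultimately show ?thesis
    using ps qs assms unfolding aeq_def by (auto intro!: exI[of _ "ps @ ?qs"])
qed

lemma aeq_context:
  "aeq A R k u v \<Longrightarrow> word_over A p \<Longrightarrow> word_over A q \<Longrightarrow> aeq A R k (p @ u @ q) (p @ v @ q)"
  using aeq_append[OF aeq_refl[of A p R 0] aeq_append[OF _ aeq_refl[of A q R 0]]] by fastforce

lemma aeq_winv:
  assumes "aeq A R k u v"
  shows "aeq A R k (winv u) (winv v)"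
proof -
  have o: "word_over A u" "word_over A v" using assms by (auto simp: aeq_def)
  have "aeq A R k (winv v @ v @ winv u) (winv v @ u @ winv u)"
    by (rule aeq_context[OF aeq_sym[OF assms]]) (use o in auto)
  moreover have "free_eq (winv u) (winv v @ v @ winv u)"
    using free_eq_sym[OF free_eq_cancel_mid'[of "[]" v "winv u"]] by simp
  moreover have "free_eq (winv v @ u @ winv u) (winv v)"
    using free_eq_cancel_mid[of "winv v" u "[]"] by simp
  ultimately show ?thesis
    using o by (meson aeq_free_trans aeq_trans_free word_over_winv)
qed

lemma aeq_move:
  assumes "aeq A R k (u @ v) w"
  shows "aeq A R k v (winv u @ w)" "aeq A R k u (w @ winv v)"
proof -
  have o: "word_over A u" "word_over A v" "word_over A w" using assms by (auto simp: aeq_def)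
  have "aeq A R k (winv u @ (u @ v)) (winv u @ w)"
    using aeq_context[OF assms, of "winv u" "[]"] o by simp
  then show "aeq A R k v (winv u @ w)"
    using free_eq_sym[OF free_eq_cancel_mid'[of "[]" u v]] o by (auto intro: aeq_free_trans)
  have "aeq A R k ((u @ v) @ winv v) (w @ winv v)"
    using aeq_context[OF assms, of "[]" "winv v"] o by simp
  then show "aeq A R k u (w @ winv v)"
    using free_eq_sym[OF free_eq_cancel_mid[of u v "[]"]] o by (auto intro: aeq_free_trans)
qed

lemma aeq_null_iff: "word_over A u \<Longrightarrow> word_over A v \<Longrightarrow> aeq A R k (u @ winv v) [] \<longleftrightarrow> aeq A R k u v"
  using aeq_move(2)[of A R k u "winv v" "[]"] aeq_move(2)[of A R k u "[]" v]
    aeq_trans_free[OF aeq_append[OF _ aeq_refl[of A "winv v" R 0], of k u v] free_eq_cancel]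
  by (auto simp: aeq_over1)

lemma aeq_relator: "r \<in> R \<Longrightarrow> word_over A r \<Longrightarrow> aeq A R 1 r []"
  unfolding aeq_def by (auto intro!: exI[of _ "[([], r)]"] simp: conj_prod_def prod_conj_def)

lemma null_word_iff_aeq: "word_over A w \<Longrightarrow> null_word A R w \<longleftrightarrow> (\<exists>k. aeq A R k w [])"
  by (auto simp: null_word_def aeq_def)

lemma area_le: assumes "aeq A R k w []" shows "area A R w \<le> k"
proof -
  from assms obtain ps where ps: "conj_prod A R ps" "length ps \<le> k" "free_eq w (prod_conj ps)"
    unfolding aeq_def by auto
  have "area A R w \<le> length ps"
    unfolding area_def by (rule Least_le) (use ps in blast)
  with ps show ?thesis by simp
qed

text \<open>Equality in the presented group with the cost forgotten.\<close>

definition geq :: "'a set \<Rightarrow> 'a word set \<Rightarrow> 'a word \<Rightarrow> 'a word \<Rightarrow> bool" where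
  "geq A R u v \<longleftrightarrow> (\<exists>k. aeq A R k u v)"

lemma geq_null_word_iff: "word_over A u \<Longrightarrow> word_over A v \<Longrightarrow> null_word A R (u @ winv v) \<longleftrightarrow> geq A R u v"
  by (simp add: null_word_iff_aeq geq_def aeq_null_iff)

lemma geq_free: "word_over A u \<Longrightarrow> word_over A v \<Longrightarrow> free_eq u v \<Longrightarrow> geq A R u v"
  by (auto simp: geq_def intro: aeq_free)

lemma geq_refl: "word_over A u \<Longrightarrow> geq A R u u"
  by (simp add: geq_free)

lemma geq_trans [trans]: "geq A R u v \<Longrightarrow> geq A R v w \<Longrightarrow> geq A R u w"
  unfolding geq_def using aeq_trans by blast

lemma geq_sym: "geq A R u v \<Longrightarrow> geq A R v u"
  unfolding geq_def using aeq_sym by blast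

lemma geq_append: "geq A R u v \<Longrightarrow> geq A R u' v' \<Longrightarrow> geq A R (u @ u') (v @ v')"
  unfolding geq_def using aeq_append by blast

lemma geq_winv: "geq A R u v \<Longrightarrow> geq A R (winv u) (winv v)"
  unfolding geq_def using aeq_winv by blast

lemma geq_move: "geq A R (u @ v) w \<Longrightarrow> geq A R v (winv u @ w)" "geq A R (u @ v) w \<Longrightarrow> geq A R u (w @ winv v)"
  unfolding geq_def using aeq_move by blast+

lemma geq_context:
  "geq A R u v \<Longrightarrow> word_over A p \<Longrightarrow> word_over A q \<Longrightarrow> geq A R (p @ u @ q) (p @ v @ q)"
  unfolding geq_def using aeq_context by blast

lemma geq_relator: "r \<in> R \<Longrightarrow> word_over A r \<Longrightarrow> geq A R r []"
  unfolding geq_def using aeq_relator by blast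

lemma geq_iff_null: "word_over A u \<Longrightarrow> word_over A v \<Longrightarrow> geq A R (u @ winv v) [] \<longleftrightarrow> geq A R u v"
  unfolding geq_def using aeq_null_iff by blast

lemma geq_commute_winv:
  assumes "geq A R (u @ v) (v @ u)"
  shows "geq A R (winv u @ v) (v @ winv u)"
  using geq_move(2)[of A R "winv u @ v" u v] geq_sym[OF geq_move(1)[OF assms]]
  by simp

lemma raag_eq_iff_geq: "raag_eq E u v \<longleftrightarrow> geq UNIV (raag_rels E) u v"
  unfolding raag_eq_def by (rule geq_null_word_iff) (auto simp: word_over_def)

section \<open>Integer powers of words and their cost\<close>

definition npow :: "'a word \<Rightarrow> nat \<Rightarrow> 'a word" where
  "npow w n = concat (replicate n w)"

text \<open>Powers are not freely reduced, so the law of exponents holds only up to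
  \<open>free_eq\<close>.\<close>

definition wpow :: "'a word \<Rightarrow> int \<Rightarrow> 'a word" where
  "wpow w k = (if k \<ge> 0 then npow w (nat k) else winv (npow w (nat (- k))))"

lemma npow_0 [simp]: "npow w 0 = []"
  by (simp add: npow_def)

lemma npow_Suc: "npow w (Suc n) = w @ npow w n"
  by (simp add: npow_def)

lemma npow_Suc': "npow w (Suc n) = npow w n @ w"
  by (induction n) (auto simp: npow_Suc)

lemma npow_Nil [simp]: "npow [] n = []"
  by (induction n) (auto simp: npow_Suc)

lemma word_over_npow [simp]: "word_over A w \<Longrightarrow> word_over A (npow w n)"
  by (induction n) (auto simp: npow_Suc)

lemma word_over_wpow [simp]: "word_over A w \<Longrightarrow> word_over A (wpow w k)"
  by (simp add: wpow_def)

lemma wpow_0 [simp]: "wpow w 0 = []"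
  by (simp add: wpow_def)

lemma wpow_Nil [simp]: "wpow [] k = []"
  by (simp add: wpow_def)

lemma wpow_1 [simp]: "wpow w 1 = w"
  by (simp add: wpow_def npow_Suc)

lemma wpow_minus: "wpow w (- k) = winv (wpow w k)"
  by (auto simp: wpow_def)

lemma wpow_minus1 [simp]: "wpow w (- 1) = winv w"
  by (simp add: wpow_minus)

lemma free_eq_wpow_Suc: "free_eq (wpow w (k + 1)) (wpow w k @ w)"
proof (cases "k \<ge> 0")
  case True
  then have "nat (k + 1) = Suc (nat k)" by simp
  with True show ?thesis by (simp add: wpow_def npow_Suc')
next
  case False
  then have "nat (- k) = Suc (nat (- (k + 1)))" by simp
  with False have "wpow w k = wpow w (k + 1) @ winv w"
    by (cases "k = -1") (auto simp: wpow_def npow_Suc)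
  then show ?thesis
    using free_eq_sym[OF free_eq_cancel_mid'[of "wpow w (k + 1)" w "[]"]] by simp
qed

lemma free_eq_wpow_pred: "free_eq (wpow w (k - 1)) (wpow w k @ winv w)"
proof -
  have "free_eq (wpow w k @ winv w) ((wpow w (k - 1) @ w) @ winv w)"
    using free_eq_append[OF free_eq_wpow_Suc[of w "k - 1"] free_eq_refl[of "winv w"]] by simp
  also have "free_eq \<dots> (wpow w (k - 1))"
    using free_eq_cancel_mid[of "wpow w (k - 1)" w "[]"] by simp
  finally show ?thesis by (rule free_eq_sym)
qed

lemma free_eq_wpow_add: "free_eq (wpow w (k + l)) (wpow w k @ wpow w l)"
proof (induction l rule: int_induct[where k = 0])
  case (step1 l)
  have "free_eq (wpow w (k + (l + 1))) (wpow w (k + l) @ w)"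
    using free_eq_wpow_Suc[of w "k + l"] by (simp add: add.assoc)
  also have "free_eq \<dots> ((wpow w k @ wpow w l) @ w)"
    by (rule free_eq_append[OF step1.IH free_eq_refl])
  also have "free_eq \<dots> (wpow w k @ wpow w (l + 1))"
    using free_eq_append[OF free_eq_refl[of "wpow w k"] free_eq_sym[OF free_eq_wpow_Suc]] by simp
  finally show ?case .
next
  case (step2 l)
  have "free_eq (wpow w (k + (l - 1))) (wpow w (k + l) @ winv w)"
    using free_eq_wpow_pred[of w "k + l"] by (simp add: add_diff_eq)
  also have "free_eq \<dots> ((wpow w k @ wpow w l) @ winv w)"
    by (rule free_eq_append[OF step2.IH free_eq_refl])
  also have "free_eq \<dots> (wpow w k @ wpow w (l - 1))"
    using free_eq_append[OF free_eq_refl[of "wpow w k"] free_eq_sym[OF free_eq_wpow_pred]] by simp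
  finally show ?case .
qed simp

lemma npow_winv: "npow (winv w) n = winv (npow w n)"
  by (induction n) (simp_all add: npow_Suc[of "winv w"] npow_Suc'[of w])

lemma wpow_winv: "wpow (winv w) k = winv (wpow w k)"
  by (simp add: wpow_def npow_winv)

lemma aeq_npow_commute:
  assumes "aeq A R c (v @ u) (u @ v)"
  shows "aeq A R (c * n) (v @ npow u n) (npow u n @ v)"
proof (induction n)
  case 0
  show ?case using aeq_over1[OF assms] by (simp add: aeq_refl)
next
  case (Suc n)
  have o: "word_over A u" "word_over A v" using assms by (auto simp: aeq_def)
  have "aeq A R c ((v @ u) @ npow u n) ((u @ v) @ npow u n)"
    using aeq_context[OF assms, of "[]" "npow u n"] o by simp
  moreover have "aeq A R (c * n) (u @ v @ npow u n) (u @ npow u n @ v)"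
    using aeq_context[OF Suc, of u "[]"] o by simp
  ultimately have "aeq A R (c + c * n) (v @ npow u (Suc n)) (npow u (Suc n) @ v)"
    using aeq_trans by (fastforce simp: npow_Suc)
  then show ?case by simp
qed

text \<open>This is the source of the quadratic cost. The two hypotheses let \<open>u\<close> and
  \<open>v\<close> commute for \<open>2 * c\<close> relators; passing from \<open>n\<close> to
  \<open>n + 1\<close> moves one \<open>v\<close> across \<open>n\<close> copies of \<open>u\<close>
  and forms one product, and \<open>2 * n + 1\<close> is the increment of the square.\<close>

lemma aeq_npow_mult:
  assumes "aeq A R c (u @ v) w" "aeq A R c (v @ u) w"
  shows "aeq A R (c * n\<^sup>2) (npow u n @ npow v n) (npow w n)"
proof (induction n)
  case 0
  show ?case by (auto intro: aeq_refl)
next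
  case (Suc n)
  have o: "word_over A u" "word_over A v" "word_over A w" using assms by (auto simp: aeq_def)
  have "aeq A R (c + c) (v @ u) (u @ v)"
    using aeq_trans[OF assms(2) aeq_sym[OF assms(1)]] .
  from aeq_npow_commute[OF this, of n]
  have "aeq A R (2 * c * n) (npow u n @ v) (v @ npow u n)" by (auto intro: aeq_sym simp: mult_2)
  from aeq_context[OF this, of u "npow v n"]
  have 1: "aeq A R (2 * c * n) (npow u (Suc n) @ npow v (Suc n)) ((u @ v) @ npow u n @ npow v n)"
    using o by (simp add: npow_Suc)
  have 2: "aeq A R (c + c * n\<^sup>2) ((u @ v) @ npow u n @ npow v n) (npow w (Suc n))"
    using aeq_append[OF assms(1) Suc] by (simp add: npow_Suc)
  from aeq_trans[OF 1 2] show ?case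
    by (rule aeq_mono) (simp add: power2_eq_square algebra_simps)
qed

lemma aeq_wpow_mult:
  assumes "aeq A R c (u @ v) w" "aeq A R c (v @ u) w"
  shows "aeq A R (c * (nat \<bar>k\<bar>)\<^sup>2) (wpow u k @ wpow v k) (wpow w k)"
  \<comment> \<open>For negative exponents the inverse reverses the product, so the roles of
    \<open>u\<close> and \<open>v\<close> are exchanged.\<close>
  using aeq_npow_mult[OF assms, of "nat k"] aeq_winv[OF aeq_npow_mult[OF assms(2,1), of "nat (- k)"]]
  by (cases "k \<ge> 0") (auto simp: wpow_def)

lemma geq_wpow_mult:
  assumes "geq A R (u @ v) w" "geq A R (v @ u) w"
  shows "geq A R (wpow u k @ wpow v k) (wpow w k)"
proof -
  from assms obtain c d where "aeq A R c (u @ v) w" "aeq A R d (v @ u) w" by (auto simp: geq_def)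
  then have "aeq A R (c + d) (u @ v) w" "aeq A R (c + d) (v @ u) w" by (auto intro: aeq_mono)
  then show ?thesis unfolding geq_def using aeq_wpow_mult by blast
qed

lemma geq_wpow: "geq A R u v \<Longrightarrow> geq A R (wpow u k) (wpow v k)"
  using geq_wpow_mult[of A R u "[]" v k] by (auto simp: wpow_def)

section \<open>Combinatorial homotopy of edge paths\<close>

text \<open>Equal vertices are allowed because neighbouring sample points often carry the same
  label.\<close>

definition adj :: "('v \<Rightarrow> 'v \<Rightarrow> bool) \<Rightarrow> 'v \<Rightarrow> 'v \<Rightarrow> bool" where
  "adj E u v \<longleftrightarrow> u = v \<or> E u v"

text \<open>Edge-path homotopy with fixed ends. Backtracking is covered by a degenerate triangle
  with \<open>a = c\<close> followed by \<open>htp_dup\<close>.\<close>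

inductive htp :: "('v \<Rightarrow> 'v \<Rightarrow> bool) \<Rightarrow> 'v list \<Rightarrow> 'v list \<Rightarrow> bool" for E where
  htp_refl: "htp E p p"
| htp_sym: "htp E p q \<Longrightarrow> htp E q p"
| htp_trans [trans]: "htp E p q \<Longrightarrow> htp E q r \<Longrightarrow> htp E p r"
| htp_context: "htp E p q \<Longrightarrow> htp E (l @ p @ r) (l @ q @ r)"
| htp_triangle: "adj E a b \<Longrightarrow> adj E b c \<Longrightarrow> adj E a c \<Longrightarrow> htp E [a, b, c] [a, c]"
| htp_dup: "htp E [a, a] [a]"

lemma htp_Cons: "htp E p q \<Longrightarrow> htp E (a # p) (a # q)"
  using htp_context[of E p q "[a]" "[]"] by simp

lemma htp_ends: "htp E p q \<Longrightarrow> (p = [] \<longleftrightarrow> q = []) \<and> (p \<noteq> [] \<longrightarrow> hd p = hd q \<and> last p = last q)"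
proof (induction rule: htp.induct)
  case (htp_context p q l r)
  then show ?case by (cases "p = []"; cases "r = []"; cases l) auto
qed auto

lemma htp_clique:
  assumes "p \<noteq> []" "\<And>a b. a \<in> set p \<Longrightarrow> b \<in> set p \<Longrightarrow> adj E a b"
  shows "htp E p [hd p, last p]"
  using assms
proof (induction p rule: list_nonempty_induct)
  case (single a)
  show ?case by (simp add: htp_sym htp_dup)
next
  case (cons a p)
  have "htp E (a # p) [a, hd p, last p]"
    by (rule htp_Cons, rule cons.IH) (use cons.prems in auto)
  also have "htp E \<dots> [a, last p]"
    by (rule htp_triangle) (use cons in auto)
  finally show ?case using cons.hyps by simp
qed

text \<open>The strip between the two paths is cut into triangles by the diagonals from
  \<open>f i\<close> to \<open>g (Suc i)\<close>; each square is crossed by two triangle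
  moves.\<close>

lemma htp_ladder:
  assumes "\<And>i. i < n \<Longrightarrow> adj E (f i) (f (Suc i)) \<and> adj E (g i) (g (Suc i)) \<and> adj E (f i) (g (Suc i))"
    and "\<And>i. i \<le> n \<Longrightarrow> adj E (f i) (g i)"
  shows "htp E (f 0 # map g [0..<Suc n]) (map f [0..<Suc n] @ [g n])"
  using assms
proof (induction n)
  case 0
  show ?case by (simp add: htp_refl)
next
  case (Suc n)
  have "htp E ([] @ (f 0 # map g [0..<Suc n]) @ [g (Suc n)]) ([] @ (map f [0..<Suc n] @ [g n]) @ [g (Suc n)])"
    by (rule htp_context, rule Suc.IH) (use Suc.prems in auto)
  also have "\<dots> = map f [0..<n] @ [f n, g n, g (Suc n)] @ []" by simp
  also have "htp E \<dots> (map f [0..<n] @ [f n, g (Suc n)] @ [])"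
    by (intro htp_context htp_triangle) (use Suc.prems in auto)
  also have "htp E \<dots> (map f [0..<n] @ [f n, f (Suc n), g (Suc n)] @ [])"
    by (intro htp_context, rule htp_sym, rule htp_triangle) (use Suc.prems in auto)
  finally show ?case by simp
qed

section \<open>Barycentric coordinates and vertex labels on the realization\<close>

lemma realization_coord:
  assumes "x \<in> flag_realization E"
  shows "(\<Sum>v\<in>UNIV. x $ v) = 1" "x $ u > 0 \<Longrightarrow> x $ v > 0 \<Longrightarrow> adj E u v"
proof -
  obtain \<sigma> where \<sigma>: "is_simplex E \<sigma>" "x \<in> convex hull ((\<lambda>v. axis v 1) ` \<sigma>)"
    using assms by (auto simp: flag_realization_def)
  \<comment> \<open>Both conditions are affine and hold at the vertices of the simplex, hence on its
    convex hull.\<close>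
  let ?H = "{x :: real^'a. (\<Sum>v\<in>UNIV. x $ v) = 1 \<and> (\<forall>v. v \<notin> \<sigma> \<longrightarrow> x $ v = 0)}"
  have "convex ?H"
    by (auto simp: convex_def sum.distrib simp flip: sum_distrib_left)
  moreover have "(\<lambda>v. axis v 1) ` \<sigma> \<subseteq> ?H"
    by (auto simp: axis_def)
  ultimately have "x \<in> ?H" using \<sigma>(2) hull_minimal by blast
  then show "(\<Sum>v\<in>UNIV. x $ v) = 1" "x $ u > 0 \<Longrightarrow> x $ v > 0 \<Longrightarrow> adj E u v"
    using \<sigma>(1) unfolding is_simplex_def adj_def by (blast, force)
qed

text \<open>On the realization the label \<open>lab x\<close> is a vertex whose open star contains the point, with
  margin \<open>1 / CARD('v)\<close>. Hence points at distance below this margin have labels in a common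
  simplex, and no Lebesgue number is needed to approximate a homotopy simplicially.\<close>

definition lab :: "real^'v::finite \<Rightarrow> 'v" where
  "lab x = (SOME v. x $ v \<ge> 1 / CARD('v))"

text \<open>The coordinates sum to 1, so one of them is at least their average.\<close>

lemma lab_ge:
  fixes x :: "real^'v::finite"
  assumes "x \<in> flag_realization E"
  shows "x $ lab x \<ge> 1 / CARD('v)"
proof -
  have "\<exists>v. x $ v \<ge> 1 / CARD('v)"
  proof (rule ccontr)
    assume "\<not> ?thesis"
    then have "(\<Sum>v\<in>UNIV. x $ v) < (\<Sum>v\<in>(UNIV::'v set). 1 / CARD('v))"
      by (intro sum_strict_mono) (auto simp: not_le)
    with realization_coord(1)[OF assms] show False by simp
  qed
  then show ?thesis unfolding lab_def by (rule someI_ex)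
qed

text \<open>A coordinate changes by at most the distance, so the coordinates of \<open>x\<close> at
  \<open>lab y\<close> and \<open>lab z\<close> are still positive, and the support of
  \<open>x\<close> is a simplex.\<close>

lemma adj_lab:
  fixes x y z :: "real^'v::finite"
  assumes "x \<in> flag_realization E" "y \<in> flag_realization E" "z \<in> flag_realization E"
    and "dist x y < 1 / CARD('v)" "dist x z < 1 / CARD('v)"
  shows "adj E (lab y) (lab z)"
proof -
  have "x $ lab w > 0" if "w \<in> flag_realization E" "dist x w < 1 / CARD('v)" for w
    using lab_ge[OF that(1)] that(2) component_le_norm_cart[of "x - w" "lab w"]
    by (simp add: dist_norm)
  then show ?thesis using realization_coord(2)[OF assms(1)] assms by blast
qed

lemma axis_in_realization [simp]: "axis v 1 \<in> flag_realization E"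
  unfolding flag_realization_def
  by (rule UnionI[of "convex hull ((\<lambda>v. axis v 1) ` {v})"])
     (auto simp: is_simplex_def intro!: exI[of _ "{v}"])

lemma segment_in_realization:
  assumes "adj E u v" "symp E"
  shows "closed_segment (axis u 1) (axis v 1) \<subseteq> flag_realization E"
proof -
  have "is_simplex E {u, v}" using assms by (auto simp: is_simplex_def adj_def dest: sympD)
  moreover have "closed_segment (axis u 1) (axis v 1) = convex hull ((\<lambda>v. axis v (1::real)) ` {u, v})"
    by (simp add: segment_convex_hull)
  ultimately show ?thesis unfolding flag_realization_def by blast
qed

section \<open>Sampling continuous paths as edge paths\<close>

definition sample :: "nat \<Rightarrow> (real \<Rightarrow> real^'v::finite) \<Rightarrow> 'v list" where
  "sample K g = map (\<lambda>i. lab (g (real i / real K))) [0..<Suc K]"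

text \<open>Joining two paths halves their parameter intervals, so \<open>poly_path p\<close> passes its vertices
  at dyadic times; it is therefore sampled at multiples of a power of two.\<close>

fun poly_path :: "'v::finite list \<Rightarrow> real \<Rightarrow> real^'v" where
  "poly_path (a # b # p) = linepath (axis a 1) (axis b 1) +++ poly_path (b # p)"
| "poly_path [a] = linepath (axis a 1) (axis a 1)"
| "poly_path [] = undefined"

lemma poly_path_ends:
  "p \<noteq> [] \<Longrightarrow> pathstart (poly_path p) = axis (hd p) 1 \<and> pathfinish (poly_path p) = axis (last p) 1"
  by (induction p rule: poly_path.induct) auto

lemma poly_path_in:
  assumes "symp E" "p \<noteq> []" "successively (adj E) p"
  shows "path (poly_path p) \<and> path_image (poly_path p) \<subseteq> flag_realization E"
  using assms(2,3)
proof (induction p rule: poly_path.induct)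
  case (1 a b p)
  have "path_image (linepath (axis a 1) (axis b 1)) \<subseteq> flag_realization E"
    using 1 segment_in_realization[OF _ assms(1)] by simp
  then show ?case using 1 poly_path_ends[of "b # p"]
    by (auto simp: path_image_join)
qed auto

lemma sample_join:
  assumes "K > 0" "pathfinish g = pathstart h"
  shows "sample (2 * K) (g +++ h) = sample K g @ tl (sample K h)"
proof -
  \<comment> \<open>The second half starts at index 1: its first sample is the junction point,
    already counted as the last one of \<open>g\<close>.\<close>
  have "[0..<Suc (2 * K)] = [0..<Suc K] @ map (\<lambda>i. i + K) [Suc 0..<Suc K]"
    by (rule nth_equalityI) (auto simp: nth_append simp del: upt_Suc)
  moreover have "(g +++ h) (real i / real (2 * K)) = g (real i / real K)" if "i \<in> set [0..<Suc K]" for i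
    using that assms(1) by (auto simp: joinpaths_def field_simps)
  moreover have "(g +++ h) (real (i + K) / real (2 * K)) = h (real i / real K)" if "i \<in> set [Suc 0..<Suc K]" for i
    using that assms(1) by (auto simp: joinpaths_def field_simps)
  moreover have "tl (sample K h) = map (\<lambda>i. lab (h (real i / real K))) [Suc 0..<Suc K]"
    by (simp add: sample_def map_tl[symmetric] del: upt_Suc)
  ultimately show ?thesis
    unfolding sample_def by (auto simp del: upt_Suc)
qed

lemma lab_axis: "lab (axis v 1) = v"
  using lab_ge[OF axis_in_realization, of v] by (auto simp: axis_def split: if_splits)

lemma hd_sample: "hd (sample K g) = lab (pathstart g)"
  unfolding sample_def pathstart_def by (simp add: hd_map del: upt_Suc)

lemma last_sample: "K > 0 \<Longrightarrow> last (sample K g) = lab (pathfinish g)"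
  unfolding sample_def pathfinish_def by simp

lemma sample_nonempty [simp]: "sample K g \<noteq> []"
  by (simp add: sample_def)

text \<open>A point of the segment has no nonzero coordinates besides those at \<open>a\<close> and
  \<open>b\<close>, so all labels lie in one simplex and \<open>htp_clique\<close> applies.\<close>

lemma htp_sample_linepath:
  assumes "adj E a b" "symp E" "K > 0"
  shows "htp E (sample K (linepath (axis a 1) (axis b 1))) [a, b]"
proof -
  let ?g = "linepath (axis a 1) (axis b 1) :: real \<Rightarrow> real^'a"
  have "set (sample K ?g) \<subseteq> {a, b}"
  proof
    fix v assume "v \<in> set (sample K ?g)"
    then obtain i where i: "i \<le> K" "v = lab (?g (real i / real K))"
      unfolding sample_def by (auto simp del: upt_Suc simp: less_Suc_eq_le)
    have "?g (real i / real K) \<in> path_image ?g"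
      using i assms(3) by (auto simp: path_image_def simp del: path_image_linepath)
    then have "?g (real i / real K) \<in> flag_realization E"
      using segment_in_realization[OF assms(1,2)] by auto
    from lab_ge[OF this] i(2) have "?g (real i / real K) $ v \<noteq> 0" by (auto simp: not_le)
    then show "v \<in> {a, b}" by (auto simp: linepath_def axis_def split: if_splits)
  qed
  moreover have adj_ab: "adj E c d" if "c \<in> {a, b}" "d \<in> {a, b}" for c d
    using that assms by (auto simp: adj_def dest: sympD)
  ultimately have "htp E (sample K ?g) [hd (sample K ?g), last (sample K ?g)]"
    by (intro htp_clique[OF sample_nonempty] adj_ab) (erule subsetD, assumption)+
  then show ?thesis using assms(3) by (simp add: hd_sample last_sample lab_axis)
qed

text \<open>Splitting off the first edge uses up one factor 2 of the sample count, so the exponent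
  must be at least the length of \<open>p\<close>.\<close>

lemma htp_sample_poly_path:
  assumes "symp E" "p \<noteq> []" "successively (adj E) p" "length p \<le> n"
  shows "htp E (sample (2 ^ n) (poly_path p)) p"
  using assms(2-)
proof (induction p arbitrary: n rule: poly_path.induct)
  case (1 a b p)
  then obtain m where n: "n = Suc m" by (cases n) auto
  let ?s = "sample (2 ^ m) (poly_path (b # p))"
  have "htp E ([] @ sample (2 ^ m) (linepath (axis a 1) (axis b 1)) @ tl ?s) ([] @ [a, b] @ tl ?s)"
    by (intro htp_context htp_sample_linepath) (use 1 assms(1) in auto)
  moreover have "b # tl ?s = ?s"
    using hd_sample[of "2 ^ m" "poly_path (b # p)"] poly_path_ends[of "b # p"] sample_nonempty
    by (metis lab_axis list.collapse list.discI list.sel(1))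
  moreover have "htp E ([a] @ ?s @ []) ([a] @ (b # p) @ [])"
    by (intro htp_context 1) (use 1 n in auto)
  ultimately show ?case
    using sample_join[of "2 ^ m" "linepath (axis a 1) (axis b 1)" "poly_path (b # p)"]
      poly_path_ends[of "b # p"] by (auto simp: n intro: htp_trans)
next
  case (2 a)
  then show ?case
    using htp_trans[OF htp_sample_linepath[of E a a "2 ^ n", unfolded linepath_refl] htp_dup] assms(1)
    by (simp add: adj_def)
qed auto

text \<open>By uniform continuity a fine enough subdivision moves consecutive points by less than
  the label margin.\<close>

lemma successively_sample:
  assumes "path g" "path_image g \<subseteq> flag_realization E"
  obtains K where "K > 0" "successively (adj E) (sample K g)"
proof -
  let ?N = "1 / real CARD('a)"
  have "uniformly_continuous_on {0..1} g"
    using assms(1) unfolding path_def by (intro compact_uniformly_continuous) auto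
  then obtain d where d: "d > 0" "\<And>s t. s \<in> {0..1} \<Longrightarrow> t \<in> {0..1} \<Longrightarrow> dist s t < d \<Longrightarrow> dist (g s) (g t) < ?N"
    unfolding uniformly_continuous_on_def by (metis zero_less_divide_1_iff of_nat_0_less_iff zero_less_card_finite dist_commute)
  obtain K :: nat where K: "1 / d < K" using reals_Archimedean2 by blast
  then have K0: "K > 0" using d(1) by (metis divide_pos_pos gr0I less_numeral_extra(1) not_less_iff_gr_or_eq of_nat_0)
  have "adj E (lab (g (i / K))) (lab (g (Suc i / K)))" if "i < K" for i
  proof -
    have "dist (real i / K) (Suc i / K) = 1 / K"
      using K0 by (simp add: dist_real_def field_simps)
    also have "\<dots> < d" using K d(1) K0 by (simp add: field_simps)
    finally have *: "dist (real i / K) (Suc i / K) < d" .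
    have i: "real i / K \<in> {0..1}" "Suc i / K \<in> {0..1}" using that by auto
    show ?thesis
      by (rule adj_lab[of "g (i / K)"]) (use i assms(2) d(2)[OF i *] in \<open>auto simp: path_image_def\<close>)
  qed
  then have "successively (adj E) (sample K g)"
    unfolding sample_def successively_conv_nth by (simp del: upt_Suc)
  with K0 show ?thesis by (rule that)
qed

section \<open>Edge paths and loops in a simply connected complex\<close>

lemma simply_connected_edge_path:
  assumes "simply_connected (flag_realization E)"
  obtains p where "p \<noteq> []" "hd p = a" "last p = b" "successively (adj E) p"
proof -
  have "path_connected (flag_realization E)"
    by (rule simply_connected_imp_path_connected[OF assms])
  then obtain g where g: "path g" "path_image g \<subseteq> flag_realization E"
      "pathstart g = axis a 1" "pathfinish g = axis b 1"
    unfolding path_connected_def by (meson axis_in_realization)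
  obtain K where "K > 0" "successively (adj E) (sample K g)"
    using successively_sample[OF g(1,2)] .
  then show ?thesis
    using that[of "sample K g"] g by (simp add: hd_sample last_sample lab_axis)
qed

text \<open>The claim is for all large \<open>n\<close>, so that \<open>n\<close> can later be
  chosen as a power of two.\<close>

lemma grid_adj:
  fixes h :: "real \<times> real \<Rightarrow> real^'v::finite"
  assumes "continuous_on ({0..1} \<times> {0..1}) h" "h ` ({0..1} \<times> {0..1}) \<subseteq> flag_realization E"
  shows "\<exists>n0. \<forall>n i j i' j'. n \<ge> n0 \<and> i \<le> n \<and> j \<le> n \<and> i' \<le> n \<and> j' \<le> n \<and>
     i' \<in> {i, Suc i} \<and> j' \<in> {j, Suc j} \<longrightarrow>
     adj E (lab (h (real i / real n, real j / real n))) (lab (h (real i' / real n, real j' / real n)))"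
proof -
  let ?N = "1 / real CARD('v)"
  have "uniformly_continuous_on ({0..1} \<times> {0..1}) h"
    using assms(1) by (intro compact_uniformly_continuous compact_Times) auto
  then obtain d where d: "d > 0"
    "\<And>s t. s \<in> {0..1} \<times> {0..1} \<Longrightarrow> t \<in> {0..1} \<times> {0..1} \<Longrightarrow> dist s t < d \<Longrightarrow> dist (h s) (h t) < ?N"
    unfolding uniformly_continuous_on_def by (metis zero_less_divide_1_iff of_nat_0_less_iff zero_less_card_finite dist_commute)
  \<comment> \<open>Both coordinates may change by \<open>1 / n\<close>, hence the 2.\<close>
  obtain n0 :: nat where n0: "2 / d < n0" using reals_Archimedean2 by blast
  show ?thesis
  proof (intro exI allI impI, elim conjE)
    fix n i j i' j' :: nat
    assume n: "n \<ge> n0" and le: "i \<le> n" "j \<le> n" "i' \<le> n" "j' \<le> n" and ij: "i' \<in> {i, Suc i}" "j' \<in> {j, Suc j}"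
    have n': "2 / d < n" using n0 n by linarith
    then have pos: "real n > 0" using d(1) by (smt (verit) divide_pos_pos)
    let ?s = "(real i / n, real j / n)" and ?t = "(real i' / n, real j' / n)"
    have in01: "?s \<in> {0..1} \<times> {0..1}" "?t \<in> {0..1} \<times> {0..1}" using le pos by auto
    have "dist ?s ?t \<le> dist (real i / n) (real i' / n) + dist (real j / n) (real j' / n)"
      unfolding dist_prod_def by (simp add: sqrt_sum_squares_le_sum)
    also have "\<dots> \<le> 1 / n + 1 / n"
      using ij pos by (intro add_mono) (auto simp: dist_real_def field_simps)
    also have "\<dots> < d" using n' pos d(1) by (simp add: field_simps)
    finally have "dist (h ?s) (h ?t) < ?N" by (intro d(2) in01)
    then show "adj E (lab (h ?s)) (lab (h ?t))"
      using in01 assms(2) by (intro adj_lab[of "h ?s"]) auto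
  qed
qed

text \<open>A null-homotopy is sampled on a grid whose rows are closed edge paths. Row 0 is
  \<open>p\<close> up to \<open>htp\<close>, the last row is constant, and neighbouring rows are
  joined by a ladder. The homotopy is free, so base points move and each step conjugates by the edge
  between consecutive base points.\<close>

lemma simply_connected_htp_loop:
  fixes E :: "'v::finite \<Rightarrow> 'v \<Rightarrow> bool"
  assumes sc: "simply_connected (flag_realization E)" and sym: "symp E"
    and p: "p \<noteq> []" "successively (adj E) p" "hd p = last p"
  shows "htp E p [hd p]"
proof -
  let ?S = "flag_realization E"
  let ?c = "linepath (axis (hd p) 1) (axis (hd p) 1) :: real \<Rightarrow> real^'v"
  have "homotopic_loops ?S (poly_path p) ?c"
    using sc poly_path_in[OF sym p(1,2)] poly_path_ends[OF p(1)] p(3)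
    unfolding simply_connected_def by auto
  then obtain h :: "real \<times> real \<Rightarrow> real^'v" where h: "continuous_on ({0..1} \<times> {0..1}) h" "h ` ({0..1} \<times> {0..1}) \<subseteq> ?S"
      and hh: "\<forall>t\<in>{0..1}. h (0, t) = poly_path p t" "\<forall>t\<in>{0..1}. h (1, t) = ?c t"
        "\<forall>s\<in>{0..1}. pathfinish (h \<circ> Pair s) = pathstart (h \<circ> Pair s)"
    unfolding homotopic_loops image_subset_iff_funcset by blast
  then have h0: "\<And>t. t \<in> {0..1} \<Longrightarrow> h (0, t) = poly_path p t" and h1: "\<And>t. t \<in> {0..1} \<Longrightarrow> h (1, t) = ?c t"
      and hl: "\<And>s. s \<in> {0..1} \<Longrightarrow> h (s, 0) = h (s, 1)"
    by (auto simp: pathstart_def pathfinish_def)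
  obtain n0 where n0: "\<And>n i j i' j'. n \<ge> n0 \<Longrightarrow> i \<le> n \<Longrightarrow> j \<le> n \<Longrightarrow> i' \<le> n \<Longrightarrow> j' \<le> n \<Longrightarrow>
     i' \<in> {i, Suc i} \<Longrightarrow> j' \<in> {j, Suc j} \<Longrightarrow>
     adj E (lab (h (real i / real n, real j / real n))) (lab (h (real i' / real n, real j' / real n)))"
    using grid_adj[OF h] by blast
  \<comment> \<open>A power of two, as required for sampling \<open>poly_path p\<close>, and at
    least \<open>n0\<close>, as required for the grid.\<close>
  define K where "K = (2::nat) ^ (max n0 (length p))"
  have "n0 \<le> max n0 (length p)" by simp
  also have "\<dots> \<le> K" unfolding K_def by (rule less_imp_le[OF less_exp])
  finally have K: "n0 \<le> K" "K > 0" by (auto simp: K_def)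
  define f where "f i j = lab (h (real i / real K, real j / real K))" for i j
  define row where "row i = map (f i) [0..<Suc K]" for i
  have adj_f: "adj E (f i j) (f i' j')"
    if "i \<le> K" "j \<le> K" "i' \<le> K" "j' \<le> K" "i' \<in> {i, Suc i}" "j' \<in> {j, Suc j}" for i j i' j'
    unfolding f_def by (rule n0) (use that K in auto)
  have adj_sym: "adj E u v \<Longrightarrow> adj E v u" for u v using sym by (auto simp: adj_def dest: sympD)
  have closed: "f i K = f i 0" if "i \<le> K" for i
    using hl[of "real i / real K"] that K by (simp add: f_def)
  have "htp E (row i) [f i 0]" if "i \<le> K" for i
    using that
  proof (induction i rule: inc_induct)
    case base
    have "row K = sample K ?c"
      unfolding row_def sample_def f_def using K(2) h1 by (auto simp del: upt_Suc)
    moreover have "f K 0 = hd p" using h1[of 0] K by (simp add: f_def lab_axis)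
    ultimately show ?case
      using htp_trans[OF htp_sample_linepath[of E "hd p" "hd p" K] htp_dup] sym K by (simp add: adj_def)
  next
    case (step i)
    let ?a = "f i 0" and ?b = "f (Suc i) 0"
    have ab: "adj E ?a ?b" using step by (intro adj_f) auto
    have loop: "htp E [?a, ?b, ?a] [?a]"
      using htp_trans[OF htp_triangle[OF ab adj_sym[OF ab]] htp_dup] by (simp add: adj_def)
    have "row i = map (f i) [0..<K] @ [?a] @ []"
      using closed[of i] step by (simp add: row_def)
    \<comment> \<open>A detour to the next base point is inserted at the end of the row, so that the
      row followed by \<open>?b\<close> is one side of a ladder.\<close>
    also have "htp E \<dots> (map (f i) [0..<K] @ [?a, ?b, ?a] @ [])"
      by (rule htp_context[OF htp_sym[OF loop]])
    also have "\<dots> = [] @ (row i @ [f (Suc i) K]) @ [?a]"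
      using closed[of i] closed[of "Suc i"] step by (simp add: row_def)
    also have "htp E \<dots> ([] @ (?a # row (Suc i)) @ [?a])"
      unfolding row_def by (intro htp_context htp_sym[OF htp_ladder]) (use step in \<open>auto intro!: adj_f\<close>)
    also have "\<dots> = [?a] @ row (Suc i) @ [?a]" by simp
    also have "htp E \<dots> ([?a] @ [?b] @ [?a])" by (rule htp_context[OF step.IH])
    also have "htp E \<dots> [?a]" using loop by simp
    finally show ?case .
  qed
  from this[of 0] have "htp E (row 0) [f 0 0]" by simp
  moreover have "row 0 = sample K (poly_path p)"
    unfolding row_def sample_def f_def using K(2) h0 by (auto simp del: upt_Suc)
  moreover have "htp E (sample K (poly_path p)) p"
    unfolding K_def by (rule htp_sample_poly_path[OF sym p(1,2)]) simp
  ultimately show ?thesis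
    using htp_ends[of E p "[f 0 0]"] p(1) by (metis htp_sym htp_trans list.sel(1))
qed

lemma htp_rev_cancel:
  assumes "symp E" "p \<noteq> []" "successively (adj E) p"
  shows "htp E (rev p @ tl p) [last p]"
  using assms(2,3)
proof (induction p rule: list_nonempty_induct)
  case (single a)
  show ?case by (simp add: htp_refl)
next
  case (cons a p)
  then obtain b q where p: "p = b # q" by (cases p) auto
  have ab: "adj E a b" "adj E b a" using cons assms(1) by (auto simp: p adj_def dest: sympD)
  have "htp E (rev q @ [b, a, b] @ q) (rev q @ [b] @ q)"
    by (intro htp_context htp_trans[OF htp_triangle[OF ab(2,1)] htp_dup]) (simp add: adj_def)
  then show ?case using cons by (auto simp: p intro: htp_trans)
qed

text \<open>Appending the reverse of \<open>q\<close> and then \<open>q\<close> itself does not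
  change \<open>p\<close> up to homotopy; the loop formed by \<open>p\<close> and the reverse of
  \<open>q\<close> then contracts and leaves \<open>q\<close>.\<close>

theorem simply_connected_htp:
  assumes "simply_connected (flag_realization E)" "symp E"
    and "p \<noteq> []" "successively (adj E) p" "q \<noteq> []" "successively (adj E) q"
    and "hd p = hd q" "last p = last q"
  shows "htp E p q"
proof -
  have flip: "(\<lambda>x y. adj E y x) = adj E" using assms(2) by (auto simp: adj_def fun_eq_iff dest: sympD)
  obtain p' l where p: "p = p' @ [l]" using assms(3) by (metis rev_exhaust)
  obtain q' where q: "q = q' @ [l]" using assms(5,8) p by (metis append_butlast_last_id last_snoc)
  have "successively (adj E) (l # rev q')"
    using assms(6) successively_rev[of "adj E" q] unfolding flip q by simp
  then have "successively (adj E) (p @ rev q')"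
    using assms(4) unfolding p by (simp add: successively_append_iff successively_Cons)
  moreover have "hd (p @ rev q') = last (p @ rev q')"
    using assms(7) by (cases q'; cases p') (auto simp: p q last_rev)
  ultimately have loop: "htp E (p @ rev q') [hd p]"
    using simply_connected_htp_loop[OF assms(1,2), of "p @ rev q'"] assms(3) by simp
  have "p = p' @ [last q] @ []" by (simp add: p q)
  also have "htp E \<dots> (p' @ (rev q @ tl q) @ [])"
    by (rule htp_context[OF htp_sym[OF htp_rev_cancel[OF assms(2,5,6)]]])
  also have "\<dots> = [] @ (p @ rev q') @ tl q" by (simp add: p q)
  also have "htp E \<dots> ([] @ [hd p] @ tl q)" by (rule htp_context[OF loop])
  also have "\<dots> = q" using assms(5,7) by simp
  finally show ?thesis .
qed

section \<open>The word problem in right-angled Artin groups\<close>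

text \<open>Pilings in the sense of Crisp, Godelle and Wiest: a letter \<open>a\<close> puts its sign on stack \<open>a\<close>
  and the neutral bead \<open>None\<close> on every stack whose generator does not commute with \<open>a\<close>.
  The last letter added that does not commute with \<open>a\<close> is thus visible on top of stack \<open>a\<close>.\<close>

type_synonym 'v piling = "'v \<Rightarrow> bool option list"

definition push :: "('v \<Rightarrow> 'v \<Rightarrow> bool) \<Rightarrow> 'v \<Rightarrow> bool \<Rightarrow> 'v piling \<Rightarrow> 'v piling" where
  "push E a e \<sigma> = (\<lambda>j. if j = a then Some e # \<sigma> j else if E a j then \<sigma> j else None # \<sigma> j)"

definition pop :: "('v \<Rightarrow> 'v \<Rightarrow> bool) \<Rightarrow> 'v \<Rightarrow> 'v piling \<Rightarrow> 'v piling" where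
  "pop E a \<sigma> = (\<lambda>j. if j \<noteq> a \<and> E a j then \<sigma> j else tl (\<sigma> j))"

definition top_is :: "'v piling \<Rightarrow> 'v \<Rightarrow> bool \<Rightarrow> bool" where
  "top_is \<sigma> a e \<longleftrightarrow> (\<exists>s. \<sigma> a = Some e # s)"

fun act :: "('v \<Rightarrow> 'v \<Rightarrow> bool) \<Rightarrow> 'v \<times> bool \<Rightarrow> 'v piling \<Rightarrow> 'v piling" where
  "act E (a, e) \<sigma> = (if top_is \<sigma> a (\<not> e) then pop E a \<sigma> else push E a e \<sigma>)"

definition acts :: "('v \<Rightarrow> 'v \<Rightarrow> bool) \<Rightarrow> 'v word \<Rightarrow> 'v piling \<Rightarrow> 'v piling" where
  "acts E w = fold (act E) w"

lemma acts_Nil [simp]: "acts E [] \<sigma> = \<sigma>"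
  and acts_Cons [simp]: "acts E (l # w) \<sigma> = acts E w (act E l \<sigma>)"
  and acts_append [simp]: "acts E (u @ v) \<sigma> = acts E v (acts E u \<sigma>)"
  by (auto simp: acts_def)

text \<open>Pilings built without cancellation. On arbitrary stacks \<open>pop\<close> could remove
  beads that no \<open>push\<close> put there, and \<open>act\<close> would not be
  invertible.\<close>

inductive valid :: "('v \<Rightarrow> 'v \<Rightarrow> bool) \<Rightarrow> 'v piling \<Rightarrow> bool" for E where
  valid_empty: "valid E (\<lambda>_. [])"
| valid_push: "valid E \<sigma> \<Longrightarrow> \<not> top_is \<sigma> a (\<not> e) \<Longrightarrow> valid E (push E a e \<sigma>)"

lemma pop_push [simp]: "pop E a (push E a e \<sigma>) = \<sigma>"
  by (auto simp: pop_def push_def)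

lemma top_push [simp]: "top_is (push E a e \<sigma>) a f \<longleftrightarrow> f = e"
  by (auto simp: top_is_def push_def)

lemma top_push_commuting: "E a b \<Longrightarrow> a \<noteq> b \<Longrightarrow> top_is (push E a e \<sigma>) b f \<longleftrightarrow> top_is \<sigma> b f"
  by (auto simp: top_is_def push_def)

lemma top_push_other: "top_is (push E a e \<sigma>) b f \<Longrightarrow> a \<noteq> b \<Longrightarrow> E a b \<and> top_is \<sigma> b f"
  by (auto simp: top_is_def push_def split: if_splits)

lemma push_commute: "E a b \<Longrightarrow> E b a \<Longrightarrow> a \<noteq> b \<Longrightarrow> push E a e (push E b f \<sigma>) = push E b f (push E a e \<sigma>)"
  by (auto simp: push_def)

section \<open>The action of the Artin group on pilings\<close>

context
  fixes E :: "'v \<Rightarrow> 'v \<Rightarrow> bool"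
  assumes sym: "symp E" and irr: "irreflp E"
begin

lemma commuting: "E a b \<Longrightarrow> E b a \<and> a \<noteq> b"
  using sym irr by (auto dest: sympD irreflpD)

text \<open>A visible signed bead can be taken as the last one pushed: every later push left it
  visible, hence commutes with it.\<close>

lemma valid_top:
  assumes "valid E \<sigma>" "top_is \<sigma> a e"
  shows "\<exists>\<tau>. valid E \<tau> \<and> \<sigma> = push E a e \<tau> \<and> \<not> top_is \<tau> a (\<not> e)"
  using assms
proof (induction rule: valid.induct)
  case valid_empty
  then show ?case by (simp add: top_is_def)
next
  case (valid_push \<sigma> b f)
  show ?case
  proof (cases "a = b")
    case True
    with valid_push show ?thesis by auto
  next
    case False
    then have ba: "E b a" "top_is \<sigma> a e" using top_push_other[OF valid_push.prems] by auto
    from valid_push.IH[OF this(2)] obtain \<tau> where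
      \<tau>: "valid E \<tau>" "\<sigma> = push E a e \<tau>" "\<not> top_is \<tau> a (\<not> e)" by blast
    have ab: "E a b" using commuting[OF ba(1)] by simp
    have "push E b f \<sigma> = push E a e (push E b f \<tau>)"
      unfolding \<tau>(2) using ba(1) ab False by (intro push_commute) auto
    moreover have "\<not> top_is \<tau> b (\<not> f)"
      using valid_push.hyps(2) ab False by (simp add: \<tau>(2) top_push_commuting)
    ultimately show ?thesis
      using \<tau> valid.valid_push[of E \<tau> b f] ba(1) False by (metis top_push_commuting)
  qed
qed

lemma act_cases:
  assumes "valid E \<sigma>"
  obtains (push) "\<not> top_is \<sigma> a (\<not> e)" "act E (a, e) \<sigma> = push E a e \<sigma>"
  | (pop) \<tau> where "valid E \<tau>" "\<sigma> = push E a (\<not> e) \<tau>" "\<not> top_is \<tau> a e" "act E (a, e) \<sigma> = \<tau>"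
proof (cases "top_is \<sigma> a (\<not> e)")
  case True
  then obtain \<tau> where "valid E \<tau>" "\<sigma> = push E a (\<not> e) \<tau>" "\<not> top_is \<tau> a e"
    using valid_top[OF assms True] by auto
  with True show ?thesis using pop by auto
qed (use push in auto)

lemma valid_act: "valid E \<sigma> \<Longrightarrow> valid E (act E l \<sigma>)"
  using act_cases[of \<sigma> "fst l" "snd l"] valid_push by (metis prod.collapse)

lemma act_inverse:
  assumes "valid E \<sigma>"
  shows "act E (a, \<not> e) (act E (a, e) \<sigma>) = \<sigma>"
  using act_cases[OF assms, of a e] by cases auto

lemma act_commute_push:
  assumes "valid E \<sigma>" "E a b" "\<not> top_is \<sigma> a (\<not> e)"
  shows "act E (a, e) (act E (b, f) \<sigma>) = act E (b, f) (act E (a, e) \<sigma>)"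
proof -
  have ab: "E a b" "E b a" "a \<noteq> b" "b \<noteq> a" using commuting assms(2) by auto
  note simps = top_push_commuting[of E a b] top_push_commuting[of E b a] ab assms(3)
  consider "\<not> top_is \<sigma> b (\<not> f)" | \<tau> where "\<sigma> = push E b (\<not> f) \<tau>"
    using valid_top[OF assms(1)] by blast
  then show ?thesis
  proof cases
    case 1
    then show ?thesis using push_commute[OF ab(1-3)] by (simp add: simps)
  next
    case 2
    then have "push E a e \<sigma> = push E b (\<not> f) (push E a e \<tau>)"
      using push_commute[OF ab(1-3)] by simp
    moreover have "\<not> top_is \<tau> a (\<not> e)" using 2 simps by simp
    ultimately show ?thesis using 2 by (simp add: simps)
  qed
qed

lemma act_commute:
  assumes "valid E \<sigma>" "E a b"
  shows "act E (a, e) (act E (b, f) \<sigma>) = act E (b, f) (act E (a, e) \<sigma>)"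
\<comment> \<open>If at least one of the two letters is pushed, \<open>act_commute_push\<close>
  applies, possibly with the letters exchanged; two pops remain.\<close>
proof (cases "top_is \<sigma> a (\<not> e) \<and> top_is \<sigma> b (\<not> f)")
  case True
  have ab: "E a b" "E b a" "a \<noteq> b" "b \<noteq> a" using commuting assms(2) by auto
  note simps = top_push_commuting[of E a b] top_push_commuting[of E b a] ab
  obtain \<tau> where \<tau>: "valid E \<tau>" "\<sigma> = push E a (\<not> e) \<tau>"
    using valid_top[OF assms(1)] True by blast
  then have "top_is \<tau> b (\<not> f)" using True by (simp add: simps)
  then obtain \<theta> where "\<tau> = push E b (\<not> f) \<theta>" using valid_top[OF \<tau>(1)] by blast
  then have "\<sigma> = push E a (\<not> e) (push E b (\<not> f) \<theta>)" "\<sigma> = push E b (\<not> f) (push E a (\<not> e) \<theta>)"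
    using \<tau>(2) push_commute[OF ab(1-3)] by simp_all
  then show ?thesis by (metis act.simps top_push pop_push)
next
  case False
  then show ?thesis
    using act_commute_push[OF assms, of e f] act_commute_push[OF assms(1), of b a f e] commuting[OF assms(2)]
    by (metis)
qed

lemma valid_acts: "valid E \<sigma> \<Longrightarrow> valid E (acts E w \<sigma>)"
  by (induction w arbitrary: \<sigma>) (auto simp: valid_act simp del: act.simps)

lemma acts_free_eq:
  assumes "free_eq u v" "valid E \<sigma>"
  shows "acts E u \<sigma> = acts E v \<sigma>"
proof -
  have red: "acts E y \<sigma> = acts E z \<sigma>" if "red1 y z" for y z
    using that assms(2) unfolding red1_def
    by (auto simp: act_inverse valid_acts simp del: act.simps)
  from assms(1) show ?thesis unfolding free_eq_def
    by (induction rule: rtranclp_induct) (auto dest: red)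
qed

lemma acts_winv:
  assumes "valid E \<sigma>"
  shows "acts E (winv w) (acts E w \<sigma>) = \<sigma>"
  using acts_free_eq[OF free_eq_cancel[of w] assms] by simp

lemma acts_relator:
  assumes "r \<in> raag_rels E" "valid E \<sigma>"
  shows "acts E r \<sigma> = \<sigma>"
proof -
  obtain a b where r: "r = [(a, False), (b, False), (a, True), (b, True)]" "E a b"
    using assms(1) by (auto simp: raag_rels_def)
  let ?\<tau> = "act E (b, False) \<sigma>"
  have "act E (a, True) (act E (b, False) (act E (a, False) \<sigma>)) = ?\<tau>"
    using act_commute[OF assms(2) r(2), of False False] act_inverse[OF valid_act[OF assms(2)], of a False "(b, False)"]
    by (simp del: act.simps)
  then show ?thesis using act_inverse[OF assms(2), of b False] r by (simp del: act.simps)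
qed

text \<open>Letters act invertibly and relators trivially, so on valid pilings the action factors
  through the group.\<close>

lemma acts_raag_null:
  assumes "geq UNIV (raag_rels E) w []" "valid E \<sigma>"
  shows "acts E w \<sigma> = \<sigma>"
proof -
  obtain ps where ps: "conj_prod UNIV (raag_rels E) ps" "free_eq w (prod_conj ps)"
    using assms(1) by (auto simp: geq_def aeq_def)
  have "acts E (prod_conj ps) \<sigma> = \<sigma>" using ps(1)
  proof (induction ps)
    case Nil
    show ?case by (simp add: prod_conj_def)
  next
    case (Cons p ps)
    obtain x r where p: "p = (x, r)" by force
    have "acts E r \<tau> = \<tau>" if "valid E \<tau>" for \<tau>
    proof (cases "r \<in> raag_rels E")
      case True
      then show ?thesis by (rule acts_relator[OF _ that])
    next
      case False
      then have "winv r \<in> raag_rels E" using Cons.prems by (auto simp: conj_prod_def p)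
      from acts_relator[OF this that] show ?thesis using acts_winv[OF that, of "winv r"] by simp
    qed
    then show ?case
      using Cons assms(2) by (auto simp: prod_conj_def p conj_prod_def valid_acts acts_winv)
  qed
  then show ?thesis using acts_free_eq[OF ps(2) assms(2)] by simp
qed

lemma acts_cancel_pair:
  assumes "valid E \<sigma>" "\<forall>l\<in>set u. E a (fst l)"
  shows "acts E ((a, e) # u @ [(a, \<not> e)]) \<sigma> = acts E u \<sigma>"
proof -
  have "acts E u (act E (a, e) \<sigma>) = act E (a, e) (acts E u \<sigma>)"
    using assms
  proof (induction u arbitrary: \<sigma>)
    case (Cons l u)
    obtain b f where "l = (b, f)" by force
    then show ?case
      using Cons act_commute[of \<sigma> a b e f, symmetric] valid_act[of \<sigma> l] by (simp del: act.simps)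
  qed simp
  then show ?thesis using act_inverse[OF valid_acts[OF assms(1)]] by (simp del: act.simps)
qed

text \<open>Without such a pair no letter ever pops a bead, so the last letter leaves a bead behind
  and the piling is not empty.\<close>

lemma trivial_has_cancelling_pair:
  assumes "acts E w (\<lambda>_. []) = (\<lambda>_. [])" "w \<noteq> []"
  shows "\<exists>p a e u q. w = p @ (a, e) # u @ (a, \<not> e) # q \<and> (\<forall>l\<in>set u. E a (fst l))"
proof (rule ccontr)
  assume none: "\<not> ?thesis"
  \<comment> \<open>A visible bead is traced back to the letter that pushed it; all later letters
    commute with \<open>a\<close>.\<close>
  have top: "\<exists>p u. v = p @ (a, e) # u \<and> (\<forall>l\<in>set u. E a (fst l))"
    if "w = v @ q" "top_is (acts E v (\<lambda>_. [])) a e" for v q a e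
    using that
  proof (induction v arbitrary: q a e rule: rev_induct)
    case Nil
    then show ?case by (simp add: top_is_def)
  next
    case (snoc l v)
    obtain b f where l: "l = (b, f)" by force
    have "\<not> top_is (acts E v (\<lambda>_. [])) b (\<not> f)"
    proof
      assume "top_is (acts E v (\<lambda>_. [])) b (\<not> f)"
      then obtain p u where "v = p @ (b, \<not> f) # u" "\<forall>l\<in>set u. E b (fst l)"
        using snoc.IH[of "l # q" b "\<not> f"] snoc.prems(1) by auto
      then have "w = p @ (b, \<not> f) # u @ (b, \<not> \<not> f) # q" using snoc.prems l by simp
      with none \<open>\<forall>l\<in>set u. E b (fst l)\<close> show False by blast
    qed
    then have "acts E (v @ [l]) (\<lambda>_. []) = push E b f (acts E v (\<lambda>_. []))" by (simp add: l)
    then have tp: "top_is (push E b f (acts E v (\<lambda>_. []))) a e" using snoc.prems by simp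
    show ?case
    proof (cases "a = b")
      case True
      then have "v @ [l] = v @ (a, e) # []" using tp l by simp
      then show ?thesis by fastforce
    next
      case False
      then have "E b a" "top_is (acts E v (\<lambda>_. [])) a e" using top_push_other[OF tp] by auto
      then obtain p u where "v = p @ (a, e) # u" "\<forall>l\<in>set u. E a (fst l)"
        using snoc.IH[of "l # q" a e] snoc.prems(1) by auto
      then have "v @ [l] = p @ (a, e) # (u @ [l]) \<and> (\<forall>l\<in>set (u @ [l]). E a (fst l))"
        using commuting[OF \<open>E b a\<close>] l by auto
      then show ?thesis by blast
    qed
  qed
  obtain v b f where w: "w = v @ [(b, f)]" using assms(2) by (metis rev_exhaust surj_pair)
  have "\<not> top_is (acts E v (\<lambda>_. [])) b (\<not> f)"
  proof
    assume "top_is (acts E v (\<lambda>_. [])) b (\<not> f)"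
    from top[OF w this] obtain p u where "v = p @ (b, \<not> f) # u" "\<forall>l\<in>set u. E b (fst l)" by blast
    then have "w = p @ (b, \<not> f) # u @ (b, \<not> \<not> f) # []" using w by simp
    with none \<open>\<forall>l\<in>set u. E b (fst l)\<close> show False by blast
  qed
  then have "acts E w (\<lambda>_. []) = push E b f (acts E v (\<lambda>_. []))" by (simp add: w)
  with assms(1) show False by (metis list.discI push_def)
qed

text \<open>Deleting the pair leaves the action unchanged. The induction therefore carries the
  triviality of the action rather than a product of relators.\<close>

lemma raag_null_induct [consumes 1, case_names Nil cancel]:
  assumes "geq UNIV (raag_rels E) w []"
    and "P []"
    and cancel: "\<And>p a e u q. P (p @ u @ q) \<Longrightarrow> \<forall>l\<in>set u. E a (fst l) \<Longrightarrow> P (p @ (a, e) # u @ (a, \<not> e) # q)"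
  shows "P w"
proof -
  have "acts E w (\<lambda>_. []) = (\<lambda>_. [])" by (rule acts_raag_null[OF assms(1) valid_empty])
  then show ?thesis
  proof (induction "length w" arbitrary: w rule: less_induct)
    case less
    show ?case
    proof (cases "w = []")
      case False
      obtain p a e u q where w: "w = p @ (a, e) # u @ (a, \<not> e) # q" "\<forall>l\<in>set u. E a (fst l)"
        using trivial_has_cancelling_pair[OF less.prems False] by blast
      have "acts E ((a, e) # u @ [(a, \<not> e)]) (acts E p (\<lambda>_. [])) = acts E u (acts E p (\<lambda>_. []))"
        by (rule acts_cancel_pair[OF valid_acts[OF valid_empty] w(2)])
      then have "acts E (p @ u @ q) (\<lambda>_. []) = (\<lambda>_. [])"
        using less.prems by (simp add: w(1) del: act.simps)
      from less.hyps[OF _ this] show ?thesis using cancel[OF _ w(2)] by (simp add: w(1))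
    qed (use assms(2) in simp)
  qed
qed

end

section \<open>Pushing fillings into the kernel\<close>

lemma eval_word_Nil [simp]: "eval_word \<phi> [] = []"
  by (simp add: eval_word_def)

lemma eval_word_append [simp]: "eval_word \<phi> (u @ v) = eval_word \<phi> u @ eval_word \<phi> v"
  by (simp add: eval_word_def)

lemma eval_word_Cons: "eval_word \<phi> ((b, e) # w) = (if e then winv (\<phi> b) else \<phi> b) @ eval_word \<phi> w"
  by (simp add: eval_word_def)

lemma eval_word_winv [simp]: "eval_word \<phi> (winv w) = winv (eval_word \<phi> w)"
  by (induction w) (auto simp: winv_Cons eval_word_Cons)

lemma eval_word_npow: "eval_word \<phi> (npow w n) = npow (eval_word \<phi> w) n"
  by (induction n) (auto simp: npow_Suc)

lemma eval_word_wpow: "eval_word \<phi> (wpow w k) = wpow (eval_word \<phi> w) k"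
  by (simp add: wpow_def eval_word_npow)

lemma free_eq_eval_word:
  assumes "free_eq u v"
  shows "free_eq (eval_word \<phi> u) (eval_word \<phi> v)"
proof -
  have "free_eq (eval_word \<phi> y) (eval_word \<phi> z)" if "red1 y z" for y z
    using that free_eq_cancel_mid free_eq_cancel_mid' unfolding red1_def
    by (auto simp: eval_word_Cons)
  with assms show ?thesis unfolding free_eq_def[of u]
    by (induction rule: rtranclp_induct) (simp, blast intro: free_eq_trans free_eq_sym)
qed

lemma length_eval_word:
  assumes "word_over A w" "\<And>b. b \<in> A \<Longrightarrow> length (\<phi> b) \<le> L"
  shows "length (eval_word \<phi> w) \<le> L * length w"
  using assms(1)
proof (induction w)
  case (Cons l w)
  then show ?case using assms(2)[of "fst l"] by (cases l) (auto simp: eval_word_Cons)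
qed simp

lemma expsum_Nil [simp]: "expsum [] = 0"
  and expsum_Cons [simp]: "expsum ((a, e) # w) = (if e then -1 else 1) + expsum w"
  and expsum_append [simp]: "expsum (u @ v) = expsum u + expsum v"
  by (auto simp: expsum_def)

lemma expsum_winv [simp]: "expsum (winv w) = - expsum w"
  by (induction w) (auto simp: winv_Cons)

lemma abs_expsum_le: "\<bar>expsum w\<bar> \<le> int (length w)"
proof (induction w)
  case (Cons l w)
  then show ?case by (cases l) auto
qed simp

lemma word_over_UNIV [simp]: "word_over UNIV w"
  by (simp add: word_over_def)

abbreviation geqA :: "('v \<Rightarrow> 'v \<Rightarrow> bool) \<Rightarrow> 'v word \<Rightarrow> 'v word \<Rightarrow> bool" where
  "geqA E \<equiv> geq UNIV (raag_rels E)"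

text \<open>This is the well-definedness of the homomorphism induced by \<open>\<phi>\<close>: it
  suffices to check the relators.\<close>

lemma geq_eval_null:
  assumes "\<And>r. r \<in> R \<Longrightarrow> geqA E (eval_word \<phi> r) []" "null_word A R w"
  shows "geqA E (eval_word \<phi> w) []"
proof -
  obtain ps where ps: "conj_prod A R ps" "free_eq w (prod_conj ps)"
    using assms(2) by (auto simp: null_word_def)
  have "geqA E (eval_word \<phi> (prod_conj ps)) []" using ps(1)
  proof (induction ps)
    case Nil
    show ?case by (simp add: prod_conj_def geq_refl)
  next
    case (Cons p ps)
    obtain y r where p: "p = (y, r)" by force
    have "geqA E (eval_word \<phi> r) []"
      using Cons.prems assms(1)[of r] geq_winv[OF assms(1)[of "winv r"]] by (auto simp: p conj_prod_def)
    from geq_context[OF this, of "eval_word \<phi> y" "winv (eval_word \<phi> y)"]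
    have "geqA E (eval_word \<phi> (y @ r @ winv y)) (eval_word \<phi> y @ winv (eval_word \<phi> y))" by simp
    also have "geqA E \<dots> []" by (rule geq_free) (auto simp: free_eq_cancel)
    finally have "geqA E (eval_word \<phi> (y @ r @ winv y) @ eval_word \<phi> (prod_conj ps)) ([] @ [])"
      using Cons by (intro geq_append) (auto simp: conj_prod_def)
    then show ?case by (simp add: p prod_conj_def)
  qed
  moreover have "geqA E (eval_word \<phi> w) (eval_word \<phi> (prod_conj ps))"
    by (rule geq_free) (auto intro: free_eq_eval_word ps)
  ultimately show ?thesis by (rule geq_trans[rotated])
qed

lemma adj_sym: "symp E \<Longrightarrow> adj E a b \<Longrightarrow> adj E b a"
  by (auto simp: adj_def dest: sympD)

lemma raag_letters_commute:
  assumes "adj E a b"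
  shows "geqA E [(a, e), (b, f)] [(b, f), (a, e)]"
proof (cases "a = b")
  case True
  show ?thesis
  proof (cases "e = f")
    case True
    then show ?thesis using \<open>a = b\<close> by (simp add: geq_refl)
  next
    case False
    then show ?thesis using \<open>a = b\<close> free_eq_cancel_letter[of a e] free_eq_cancel_letter[of a f]
      by (intro geq_free) (auto intro: free_eq_trans free_eq_sym)
  qed
next
  case False
  then have "E a b" using assms by (simp add: adj_def)
  then have "geqA E ([(a, False), (b, False)] @ winv [(b, False), (a, False)]) []"
    by (intro geq_relator) (auto simp: raag_rels_def winv_def)
  then have ff: "geqA E ([(a, False)] @ [(b, False)]) ([(b, False)] @ [(a, False)])"
    by (subst (asm) geq_iff_null) auto
  have tf: "geqA E ([(a, e)] @ [(b, False)]) ([(b, False)] @ [(a, e)])"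
    using ff geq_commute_winv[OF ff] by (cases e) (auto simp: winv_def)
  show ?thesis
    using tf geq_sym[OF geq_commute_winv[OF geq_sym[OF tf]]] by (cases f) (auto simp: winv_def)
qed

text \<open>The first product is a free cancellation. For the second, commuting within each factor
  brings \<open>b\<close> next to its inverse, and then \<open>a\<close> and \<open>c\<close> are
  exchanged.\<close>

lemma raag_edge_mult:
  assumes "symp E" "adj E a b" "adj E b c" "adj E a c"
  shows "geqA E ([(a, False), (b, True)] @ [(b, False), (c, True)]) [(a, False), (c, True)]"
    and "geqA E ([(b, False), (c, True)] @ [(a, False), (b, True)]) [(a, False), (c, True)]"
proof -
  have bb: "geqA E ([(a, False)] @ [(b, True), (b, False)] @ [(c, True)]) ([(a, False)] @ [] @ [(c, True)])"
    for a b c by (rule geq_context) (auto intro!: geq_free simp: free_eq_cancel_letter[of _ True, simplified])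
  then show "geqA E ([(a, False), (b, True)] @ [(b, False), (c, True)]) [(a, False), (c, True)]" by simp
  have "geqA E ([(b, False), (c, True)] @ [(a, False), (b, True)]) ([(c, True), (b, False)] @ [(b, True), (a, False)])"
    by (intro geq_append raag_letters_commute) (use assms in \<open>auto intro: adj_sym\<close>)
  also have "geqA E \<dots> ([(c, True)] @ [] @ [(a, False)])"
    using geq_context[of UNIV "raag_rels E" "[(b, False), (b, True)]" "[]" "[(c, True)]" "[(a, False)]"]
    by (simp add: geq_free free_eq_cancel_letter[of _ False, simplified])
  also have "geqA E \<dots> [(a, False), (c, True)]"
    using raag_letters_commute[OF adj_sym[OF assms(1,4)], of True False] by simp
  finally show "geqA E ([(b, False), (c, True)] @ [(a, False), (b, True)]) [(a, False), (c, True)]" .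
qed

section \<open>Powers multiplied along edge paths\<close>

fun path_pow :: "('v \<Rightarrow> 'v \<Rightarrow> 'b word) \<Rightarrow> int \<Rightarrow> 'v list \<Rightarrow> 'b word" where
  "path_pow x k (a # b # p) = wpow (x a b) k @ path_pow x k (b # p)"
| "path_pow x k [a] = []"
| "path_pow x k [] = []"

lemma path_pow_append: "path_pow x k (p @ a # q) = path_pow x k (p @ [a]) @ path_pow x k (a # q)"
  by (induction x k p rule: path_pow.induct) auto

lemma path_pow_context:
  assumes "p \<noteq> []"
  shows "path_pow x k (l @ p @ r) = path_pow x k (l @ [hd p]) @ path_pow x k p @ path_pow x k (last p # r)"
proof -
  obtain a p' where p: "p = a # p'" using assms by (cases p) auto
  obtain q b where q: "p = q @ [b]" using assms by (metis rev_exhaust)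
  have "path_pow x k (l @ p @ r) = path_pow x k (l @ [hd p]) @ path_pow x k (p @ r)"
    using path_pow_append[of x k l a "p' @ r"] by (simp add: p)
  also have "path_pow x k (p @ r) = path_pow x k p @ path_pow x k (last p # r)"
    using path_pow_append[of x k q b r] by (simp add: q)
  finally show ?thesis by simp
qed

lemma path_pow_0 [simp]: "path_pow x 0 p = []"
  by (induction x "0::int" p rule: path_pow.induct) auto

text \<open>The word \<open>x a b\<close> stands for the element \<open>a b\<^sup>-\<^sup>1\<close> of the kernel.\<close>

locale pushing =
  fixes E :: "'v::finite \<Rightarrow> 'v \<Rightarrow> bool" and A :: "'b set" and R :: "'b word set"
    and x :: "'v \<Rightarrow> 'v \<Rightarrow> 'b word"
  assumes sym: "symp E" and irr: "irreflp E" and sc: "simply_connected (flag_realization E)"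
    and over [simp]: "word_over A (x a b)"
    and mult: "adj E a b \<Longrightarrow> adj E b c \<Longrightarrow> adj E a c \<Longrightarrow> geq A R (x a b @ x b c) (x a c)"
    and mult': "adj E a b \<Longrightarrow> adj E b c \<Longrightarrow> adj E a c \<Longrightarrow> geq A R (x b c @ x a b) (x a c)"
begin

lemma over_path_pow [simp]: "word_over A (path_pow x k p)"
  by (induction p rule: induct_list012) auto

text \<open>The constant does not depend on \<open>k\<close>: the two families agree at a cost
  quadratic in the exponent.\<close>

definition qeq :: "(int \<Rightarrow> 'b word) \<Rightarrow> (int \<Rightarrow> 'b word) \<Rightarrow> bool" where
  "qeq F G \<longleftrightarrow> (\<exists>C. \<forall>k. aeq A R (C * (nat \<bar>k\<bar>)\<^sup>2) (F k) (G k))"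

lemma qeq_refl: "(\<And>k. word_over A (F k)) \<Longrightarrow> qeq F F"
  unfolding qeq_def by (simp add: aeq_refl)

lemma qeq_trans: "qeq F G \<Longrightarrow> qeq G H \<Longrightarrow> qeq F H"
proof -
  assume "qeq F G" "qeq G H"
  then obtain C D where "\<And>k. aeq A R (C * (nat \<bar>k\<bar>)\<^sup>2) (F k) (G k)" "\<And>k. aeq A R (D * (nat \<bar>k\<bar>)\<^sup>2) (G k) (H k)"
    unfolding qeq_def by blast
  then have "aeq A R ((C + D) * (nat \<bar>k\<bar>)\<^sup>2) (F k) (H k)" for k
    using aeq_trans by (fastforce simp: add_mult_distrib)
  then show ?thesis unfolding qeq_def by blast
qed

lemma qeq_sym: "qeq F G \<Longrightarrow> qeq G F"
  unfolding qeq_def using aeq_sym by blast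

text \<open>A homotopy consists of finitely many moves independent of \<open>k\<close>, and each
  triangle move costs quadratically many relators by \<open>aeq_wpow_mult\<close>.\<close>

lemma qeq_path_pow: "htp E p q \<Longrightarrow> qeq (\<lambda>k. path_pow x k p) (\<lambda>k. path_pow x k q)"
proof (induction rule: htp.induct)
  case (htp_refl p)
  show ?case by (simp add: qeq_refl)
next
  case (htp_sym p q)
  show ?case by (rule qeq_sym[OF htp_sym.IH])
next
  case (htp_trans p q r)
  then show ?case by (blast intro: qeq_trans)
next
  case (htp_context p q l r)
  show ?case
  proof (cases "p = []")
    case True
    then show ?thesis using htp_ends[OF htp_context.hyps] by (simp add: qeq_refl)
  next
    case False
    then have *: "q \<noteq> []" "hd q = hd p" "last q = last p" using htp_ends[OF htp_context.hyps] by auto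
    from htp_context.IH obtain C
      where "\<And>k. aeq A R (C * (nat \<bar>k\<bar>)\<^sup>2) (path_pow x k p) (path_pow x k q)" unfolding qeq_def by blast
    then have "aeq A R (C * (nat \<bar>k\<bar>)\<^sup>2) (path_pow x k (l @ p @ r)) (path_pow x k (l @ q @ r))" for k
      unfolding path_pow_context[OF False] path_pow_context[OF *(1)] * by (intro aeq_context) auto
    then show ?thesis unfolding qeq_def by blast
  qed
next
  case (htp_triangle a b c)
  then obtain m n where "aeq A R m (x a b @ x b c) (x a c)" "aeq A R n (x b c @ x a b) (x a c)"
    using mult mult' unfolding geq_def by blast
  then have "aeq A R (m + n) (x a b @ x b c) (x a c)" "aeq A R (m + n) (x b c @ x a b) (x a c)"
    by (auto intro: aeq_mono)
  from aeq_wpow_mult[OF this] show ?case unfolding qeq_def by auto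
next
  case (htp_dup a)
  have "adj E a a" by (simp add: adj_def)
  \<comment> \<open>The word \<open>x a a\<close> is idempotent in the group, hence trivial.\<close>
  then obtain m where m: "aeq A R m (x a a @ x a a) (x a a)"
    using mult unfolding geq_def by blast
  have "aeq A R m (x a a) []"
    using aeq_trans_free[OF aeq_move(1)[OF m] free_eq_cancel'] by simp
  then have "aeq A R m (x a a @ []) []" "aeq A R m ([] @ x a a) []" by simp_all
  from aeq_wpow_mult[OF this] show ?case unfolding qeq_def by auto
qed

definition route :: "'v \<Rightarrow> 'v list" where
  "route v = (SOME p. p \<noteq> [] \<and> hd p = undefined \<and> last p = v \<and> successively (adj E) p)"

lemma route: "route v \<noteq> []" "hd (route v) = undefined" "last (route v) = v" "successively (adj E) (route v)"
proof -
  obtain p where "p \<noteq> [] \<and> hd p = undefined \<and> last p = v \<and> successively (adj E) p"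
    using simply_connected_edge_path[OF sc, of undefined v] by blast
  then have "route v \<noteq> [] \<and> hd (route v) = undefined \<and> last (route v) = v \<and> successively (adj E) (route v)"
    unfolding route_def by (rule someI)
  then show "route v \<noteq> []" "hd (route v) = undefined" "last (route v) = v" "successively (adj E) (route v)"
    by auto
qed

text \<open>\<open>P v k\<close> represents \<open>o\<^sup>k v\<^sup>-\<^sup>k\<close>, where the base vertex \<open>o\<close> is \<open>undefined\<close>.\<close>

definition P :: "'v \<Rightarrow> int \<Rightarrow> 'b word" where
  "P v k = path_pow x k (route v)"

lemma over_P [simp]: "word_over A (P v k)"
  by (simp add: P_def)

lemma P_0 [simp]: "P v 0 = []"
  by (simp add: P_def)

text \<open>The route to \<open>a\<close> extended by the edge and the route to \<open>b\<close>
  have the same ends, so simple connectivity makes them homotopic.\<close>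

lemma P_edge:
  assumes "adj E a b"
  shows "qeq (\<lambda>k. P a k @ wpow (x a b) k) (P b)"
proof -
  have "htp E (route a @ [b]) (route b)"
    by (rule simply_connected_htp[OF sc sym])
      (use route[of a] route[of b] assms in \<open>auto simp: successively_append_iff\<close>)
  moreover have "path_pow x k (route a @ [b]) = P a k @ wpow (x a b) k" for k
    using path_pow_context[OF route(1), of x k "[]" a "[b]"] route(3)[of a] by (simp add: P_def)
  ultimately show ?thesis using qeq_path_pow unfolding P_def by fastforce
qed

definition area_const :: nat where
  "area_const = (SOME C. \<forall>a b k. adj E a b \<longrightarrow> aeq A R (C * (nat \<bar>k\<bar>)\<^sup>2) (P a k @ wpow (x a b) k) (P b k))"

lemma P_edge_aeq:
  assumes "adj E a b"
  shows "aeq A R (area_const * (nat \<bar>k\<bar>)\<^sup>2) (P a k @ wpow (x a b) k) (P b k)"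
proof -
  have "\<exists>C. adj E a b \<longrightarrow> (\<forall>k. aeq A R (C * (nat \<bar>k\<bar>)\<^sup>2) (P a k @ wpow (x a b) k) (P b k))" for a b
    using P_edge unfolding qeq_def by blast
  then obtain D where D: "\<And>a b k. adj E a b \<Longrightarrow> aeq A R (D a b * (nat \<bar>k\<bar>)\<^sup>2) (P a k @ wpow (x a b) k) (P b k)"
    by metis
  \<comment> \<open>There are finitely many pairs of vertices, so the sum bounds all their constants
    at once.\<close>
  let ?C = "\<Sum>(a, b)\<in>UNIV. D a b"
  have "D a b \<le> ?C" for a b
    using member_le_sum[of "(a, b)" UNIV "\<lambda>(a, b). D a b"] by simp
  then have "\<exists>C. \<forall>a b k. adj E a b \<longrightarrow> aeq A R (C * (nat \<bar>k\<bar>)\<^sup>2) (P a k @ wpow (x a b) k) (P b k)"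
    using D by (blast intro: aeq_mono mult_le_mono1)
  from someI_ex[OF this] show ?thesis
    using assms unfolding area_const_def by blast
qed

text \<open>Reading \<open>w\<close> from height \<open>h\<close> and returning to height 0 along powers of \<open>o\<close> after every
  letter turns \<open>w\<close> into a kernel word for \<open>o ^ h * w * o ^ - (h + expsum w)\<close>.\<close>

fun pushed :: "int \<Rightarrow> 'v word \<Rightarrow> 'b word" where
  "pushed h [] = []"
| "pushed h ((v, e) # w) =
     P v h @ winv (P v (h + (if e then -1 else 1))) @ pushed (h + (if e then -1 else 1)) w"

lemma over_pushed [simp]: "word_over A (pushed h w)"
  by (induction h w rule: pushed.induct) (auto simp del: word_over_Cons)

lemma pushed_append: "pushed h (u @ v) = pushed h u @ pushed (h + expsum u) v"
  by (induction h u rule: pushed.induct) (auto simp: algebra_simps)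

lemma pushed_winv: "pushed (h + expsum w) (winv w) = winv (pushed h w)"
  by (induction h w rule: pushed.induct) (auto simp: winv_Cons pushed_append algebra_simps)

text \<open>Substituting \<open>P b k = P a k (x a b)\<^sup>k\<close> at both heights costs quadratically many relators;
  afterwards both sides of a commutation in \<open>pushed_swap\<close> agree freely.\<close>

lemma pushed_letter:
  assumes "adj E a b" "\<bar>h\<bar> \<le> int N" "\<bar>h'\<bar> \<le> int N"
  shows "aeq A R (2 * area_const * N\<^sup>2) (P b h @ winv (P b h')) (P a h @ wpow (x a b) (h - h') @ winv (P a h'))"
proof -
  let ?c = "area_const * N\<^sup>2"
  have P: "aeq A R ?c (P b k) (P a k @ wpow (x a b) k)" if "\<bar>k\<bar> \<le> int N" for k
    using that by (intro aeq_mono[OF aeq_sym[OF P_edge_aeq[OF assms(1)]]] mult_le_mono2 power_mono) auto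
  have "aeq A R (?c + ?c) (P b h @ winv (P b h')) ((P a h @ wpow (x a b) h) @ winv (P a h' @ wpow (x a b) h'))"
    by (intro aeq_append aeq_winv P assms)
  moreover have "free_eq ((P a h @ wpow (x a b) h) @ winv (P a h' @ wpow (x a b) h'))
      (P a h @ wpow (x a b) (h - h') @ winv (P a h'))"
    using free_eq_context[OF free_eq_sym[OF free_eq_wpow_add[of "x a b" h "- h'"]], of "P a h" "winv (P a h')"]
    by (simp add: wpow_minus)
  ultimately have "aeq A R (?c + ?c) (P b h @ winv (P b h')) (P a h @ wpow (x a b) (h - h') @ winv (P a h'))"
    by (rule aeq_trans_free) simp
  then show ?thesis by (simp add: mult_2 add_mult_distrib)
qed

lemma pushed_swap:
  assumes "adj E a b" "\<bar>h\<bar> + 2 \<le> int N"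
  shows "aeq A R (4 * area_const * N\<^sup>2) (pushed h [(a, e), (b, f)]) (pushed h [(b, f), (a, e)])"
proof -
  define s t :: int where "s = (if e then -1 else 1)" and "t = (if f then -1 else 1)"
  have st: "\<bar>s\<bar> = 1" "\<bar>t\<bar> = 1" by (auto simp: s_def t_def)
  \<comment> \<open>Only the letter \<open>b\<close> is rewritten, at height \<open>h + s\<close> in
    one order and \<open>h\<close> in the other; both orders then reduce freely to
    \<open>?m\<close>.\<close>
  let ?c = "2 * area_const * N\<^sup>2" and ?m = "P a h @ wpow (x a b) (- t) @ winv (P a (h + s + t))"
  have "aeq A R ?c (pushed h [(a, e), (b, f)])
      ((P a h @ winv (P a (h + s))) @ P a (h + s) @ wpow (x a b) (- t) @ winv (P a (h + s + t)))"
    using aeq_append[OF aeq_refl[of A "P a h @ winv (P a (h + s))" R 0]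
        pushed_letter[OF assms(1), of "h + s" N "h + s + t"]] assms(2) st
    by (simp add: s_def[symmetric] t_def[symmetric])
  moreover have "free_eq \<dots> ?m"
    using free_eq_cancel_mid'[of "P a h" "P a (h + s)"] by simp
  ultimately have 1: "aeq A R ?c (pushed h [(a, e), (b, f)]) ?m"
    by (rule aeq_trans_free) simp
  have "aeq A R ?c (pushed h [(b, f), (a, e)])
      ((P a h @ wpow (x a b) (- t) @ winv (P a (h + t))) @ P a (h + t) @ winv (P a (h + s + t)))"
    using aeq_append[OF pushed_letter[OF assms(1), of h N "h + t"]
        aeq_refl[of A "P a (h + t) @ winv (P a (h + s + t))" R 0]] assms(2) st
    by (simp add: s_def[symmetric] t_def[symmetric] ac_simps)
  moreover have "free_eq \<dots> ?m"
    using free_eq_cancel_mid'[of "P a h @ wpow (x a b) (- t)" "P a (h + t)"] by simp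
  ultimately have 2: "aeq A R ?c (pushed h [(b, f), (a, e)]) ?m"
    by (rule aeq_trans_free) simp
  from aeq_trans[OF 1 aeq_sym[OF 2]] show ?thesis by (simp add: add_mult_distrib[symmetric])
qed

text \<open>The letter \<open>a\<close> is swapped past \<open>u\<close> one letter at a time until
  it meets its inverse. Every height on the way stays below \<open>N\<close>, so each swap has the
  same bound.\<close>

lemma pushed_cancel:
  assumes "\<forall>l\<in>set u. E a (fst l)" "\<bar>h\<bar> + int (length u) + 2 \<le> int N"
  shows "aeq A R (length u * (4 * area_const * N\<^sup>2)) (pushed h ((a, e) # u @ [(a, \<not> e)])) (pushed h u)"
  using assms
proof (induction u arbitrary: h)
  case Nil
  have "free_eq (pushed h [(a, e), (a, \<not> e)]) (P a h @ winv (P a h))"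
    using free_eq_cancel_mid'[of "P a h"] by simp
  then have "free_eq (pushed h [(a, e), (a, \<not> e)]) []"
    using free_eq_cancel free_eq_trans by blast
  then show ?case by (intro aeq_free) (auto simp del: pushed.simps(2))
next
  case (Cons l u)
  obtain b f where l: "l = (b, f)" by force
  let ?v = "u @ [(a, \<not> e)]" and ?h = "h + (if f then -1 else 1)" and ?c = "4 * area_const * N\<^sup>2"
  have "aeq A R ?c (pushed h [(a, e), (b, f)]) (pushed h [(b, f), (a, e)])"
    by (rule pushed_swap) (use Cons.prems in \<open>auto simp: l adj_def\<close>)
  from aeq_context[OF this, of "[]" "pushed (h + expsum [(a, e), (b, f)]) ?v"]
  have "aeq A R ?c (pushed h ((a, e) # (b, f) # ?v)) (pushed h ((b, f) # (a, e) # ?v))"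
    using pushed_append[of h "[(a, e), (b, f)]" ?v] pushed_append[of h "[(b, f), (a, e)]" ?v]
    by (simp add: ac_simps)
  moreover have "aeq A R (length u * ?c) (pushed ?h ((a, e) # ?v)) (pushed ?h u)"
    by (rule Cons.IH) (use Cons.prems in auto)
  from aeq_context[OF this, of "pushed h [(b, f)]" "[]"]
  have "aeq A R (length u * ?c) (pushed h ((b, f) # (a, e) # ?v)) (pushed h ((b, f) # u))"
    by simp
  ultimately have "aeq A R (?c + length u * ?c) (pushed h ((a, e) # (b, f) # ?v)) (pushed h ((b, f) # u))"
    by (rule aeq_trans)
  then show ?case by (simp add: l)
qed

text \<open>Removing one cancelling pair takes at most \<open>N\<close> swaps, each quadratic in
  \<open>N\<close>. The resulting cubic cost is charged to the two letters removed.\<close>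

lemma pushed_null:
  assumes "geqA E w []" "length w + 2 \<le> N"
  shows "aeq A R (length w * (4 * area_const * N ^ 3)) (pushed 0 w) []"
  using assms
proof (induction w rule: raag_null_induct[OF sym irr, consumes 1])
  case 1
  then show ?case by (auto intro: aeq_refl)
next
  case (2 p a e u q)
  let ?c = "4 * area_const * N\<^sup>2" and ?h = "expsum p"
  have "aeq A R (length u * ?c) (pushed ?h ((a, e) # u @ [(a, \<not> e)])) (pushed ?h u)"
    by (rule pushed_cancel) (use 2 abs_expsum_le[of p] in auto)
  then have "aeq A R (N * ?c) (pushed ?h ((a, e) # u @ [(a, \<not> e)])) (pushed ?h u)"
    by (rule aeq_mono) (use 2 in \<open>auto intro!: mult_le_mono\<close>)
  from aeq_context[OF this, of "pushed 0 p" "pushed (?h + expsum u) q"]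
  have "aeq A R (N * ?c) (pushed 0 (p @ ((a, e) # u @ [(a, \<not> e)]) @ q)) (pushed 0 (p @ u @ q))"
    \<comment> \<open>The deleted letters have total exponent 0, so \<open>q\<close> is read from
      the same height before and after.\<close>
    unfolding pushed_append[of _ p] pushed_append[of _ _ q]
    by (cases e) (simp_all del: pushed.simps)
  moreover have "aeq A R (length (p @ u @ q) * (4 * area_const * N ^ 3)) (pushed 0 (p @ u @ q)) []"
    using 2 by simp
  ultimately have "aeq A R (N * ?c + length (p @ u @ q) * (4 * area_const * N ^ 3))
      (pushed 0 (p @ ((a, e) # u @ [(a, \<not> e)]) @ q)) []"
    by (rule aeq_trans)
  then have "aeq A R (N * ?c + length (p @ u @ q) * (4 * area_const * N ^ 3))
      (pushed 0 (p @ (a, e) # u @ (a, \<not> e) # q)) []"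
    by (simp del: pushed.simps)
  then show ?case
    by (rule aeq_mono) (use 2 in \<open>auto simp: power3_eq_cube power2_eq_square algebra_simps\<close>)
qed

text \<open>The ends of an edge commute, so the power splits as \<open>a\<close> to the
  \<open>k\<close> times \<open>b\<close> to the \<open>- k\<close>, and the product along the path
  telescopes.\<close>

lemma eval_path_pow:
  assumes x: "\<And>a b. adj E a b \<Longrightarrow> geqA E (eval_word \<phi> (x a b)) [(a, False), (b, True)]"
    and "p \<noteq> []" "successively (adj E) p"
  shows "geqA E (eval_word \<phi> (path_pow x k p)) (wpow [(hd p, False)] k @ winv (wpow [(last p, False)] k))"
  using assms(2,3)
proof (induction p rule: induct_list012)
  case (2 a)
  show ?case by (auto intro!: geq_sym[OF geq_free] simp: free_eq_cancel)
next
  case (3 a b p)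
  let ?w = "\<lambda>a. wpow [(a, False)] k"
  have ab: "adj E a b" using 3 by simp
  have "geqA E (wpow ([(a, False)]) k @ wpow [(b, True)] k) (wpow [(a, False), (b, True)] k)"
    using geq_wpow_mult[of UNIV "raag_rels E" "[(a, False)]" "[(b, True)]" "[(a, False), (b, True)]" k]
      geq_sym[OF raag_letters_commute[OF ab, of False True]] by (simp add: geq_refl)
  then have "geqA E (?w a @ winv (?w b)) (wpow [(a, False), (b, True)] k)"
    using wpow_winv[of "[(b, False)]" k] by (simp add: winv_Cons)
  also have "geqA E \<dots> (wpow (eval_word \<phi> (x a b)) k)"
    by (rule geq_wpow[OF geq_sym[OF x[OF ab]]])
  finally have "geqA E (wpow (eval_word \<phi> (x a b)) k) (?w a @ winv (?w b))" by (rule geq_sym)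
  moreover have "geqA E (eval_word \<phi> (path_pow x k (b # p))) (?w b @ winv (?w (last (b # p))))"
    using "3.IH"(2) "3.prems" by simp
  ultimately have "geqA E (eval_word \<phi> (path_pow x k (a # b # p)))
      ((?w a @ winv (?w b)) @ ?w b @ winv (?w (last (b # p))))"
    unfolding path_pow.simps eval_word_append eval_word_wpow by (rule geq_append)
  also have "geqA E \<dots> (?w a @ winv (?w (last (b # p))))"
    using free_eq_cancel_mid'[of "?w a" "?w b"] by (intro geq_free) auto
  finally show ?case by simp
qed simp

text \<open>Between consecutive letters the powers of the base vertex cancel; within a letter the
  powers of \<open>v\<close> at the two heights leave the letter itself.\<close>

lemma eval_pushed:
  assumes x: "\<And>a b. adj E a b \<Longrightarrow> geqA E (eval_word \<phi> (x a b)) [(a, False), (b, True)]"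
  shows "geqA E (eval_word \<phi> (pushed h w))
    (wpow [(undefined, False)] h @ w @ winv (wpow [(undefined, False)] (h + expsum w)))"
proof (induction w arbitrary: h)
  case Nil
  show ?case by (auto intro!: geq_sym[OF geq_free] simp: free_eq_cancel)
next
  case (Cons l w)
  obtain v e where l: "l = (v, e)" by force
  let ?h = "h + (if e then -1 else 1)" and ?o = "wpow [(undefined, False)]" and ?v = "wpow [(v, False)]"
  have P: "geqA E (eval_word \<phi> (P v k)) (?o k @ winv (?v k))" for k
    using eval_path_pow[OF x route(1)[of v] route(4)[of v], of k] route[of v] by (simp add: P_def)
  have "geqA E (eval_word \<phi> (pushed h (l # w)))
     ((?o h @ winv (?v h)) @ winv (?o ?h @ winv (?v ?h)) @ ?o ?h @ w @ winv (?o (?h + expsum w)))"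
    unfolding l pushed.simps eval_word_append eval_word_winv
    by (intro geq_append geq_winv P Cons)
  also have "geqA E \<dots> (?o h @ [(v, e)] @ w @ winv (?o (?h + expsum w)))"
  proof (rule geq_free)
    let ?r = "w @ winv (?o (?h + expsum w))"
    have "free_eq ((?o h @ winv (?v h)) @ winv (?o ?h @ winv (?v ?h)) @ ?o ?h @ ?r) (?o h @ (winv (?v h) @ ?v ?h) @ ?r)"
      using free_eq_cancel_mid'[of "?o h @ winv (?v h) @ ?v ?h" "?o ?h" ?r] by simp
    moreover have "free_eq (winv (?v h) @ ?v ?h) [(v, e)]"
      using free_eq_sym[OF free_eq_wpow_add[of "[(v, False)]" "- h" ?h]]
      by (cases e) (auto simp: wpow_minus winv_Cons)
    ultimately show "free_eq ((?o h @ winv (?v h)) @ winv (?o ?h @ winv (?v ?h)) @ ?o ?h @ ?r) (?o h @ [(v, e)] @ ?r)"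
      using free_eq_context free_eq_trans by blast
  qed auto
  finally show ?case by (simp add: l add.assoc)
qed

text \<open>The image of each generator has exponent sum 0, so each block starts at height 0 again
  and the generators can be replaced independently.\<close>

lemma pushed_eval_word:
  assumes "\<And>b. b \<in> A \<Longrightarrow> expsum (\<phi> b) = 0"
    and "\<And>b. b \<in> A \<Longrightarrow> aeq A R c [(b, False)] (pushed 0 (\<phi> b))" and "word_over A w"
  shows "aeq A R (c * length w) w (pushed 0 (eval_word \<phi> w))"
  using assms(3)
proof (induction w)
  case (Cons l w)
  obtain b e where l: "l = (b, e)" by force
  have b: "b \<in> A" using Cons.prems l by simp
  let ?b = "if e then winv (\<phi> b) else \<phi> b"
  have "pushed 0 (winv (\<phi> b)) = winv (pushed 0 (\<phi> b))"
    using pushed_winv[of 0 "\<phi> b"] assms(1)[OF b] by simp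
  then have "aeq A R c [(b, e)] (pushed 0 ?b)"
    using assms(2)[OF b] aeq_winv[OF assms(2)[OF b]] by (auto simp: winv_Cons)
  from aeq_append[OF this Cons.IH] show ?case
    using Cons.prems assms(1)[OF b] by (auto simp: l eval_word_Cons pushed_append)
qed (auto intro: aeq_refl)

text \<open>A word is first rewritten as the pushed form of its image at linear cost, and the pushed
  form is then filled. This gives the Dehn bound and also the injectivity needed for the explicit
  presentation.\<close>

theorem quartic_filling:
  assumes "finite A" "\<And>b. b \<in> A \<Longrightarrow> expsum (\<phi> b) = 0"
    and "\<And>b. b \<in> A \<Longrightarrow> geq A R [(b, False)] (pushed 0 (\<phi> b))"
  shows "\<exists>K. \<forall>w. word_over A w \<and> geqA E (eval_word \<phi> w) [] \<longrightarrow> aeq A R (K * (length w + 1) ^ 4) w []"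
proof -
  obtain d where d: "\<And>b. b \<in> A \<Longrightarrow> aeq A R (d b) [(b, False)] (pushed 0 (\<phi> b))"
    using assms(3) unfolding geq_def by metis
  define c where "c = sum d A"
  \<comment> \<open>The summand 2 supplies the height margin required by
    \<open>pushed_null\<close>.\<close>
  define L where "L = (\<Sum>b\<in>A. length (\<phi> b)) + 2"
  have c: "aeq A R c [(b, False)] (pushed 0 (\<phi> b))" if "b \<in> A" for b
    by (rule aeq_mono[OF d[OF that]]) (use that assms(1) in \<open>auto simp: c_def intro: member_le_sum\<close>)
  have L: "length (\<phi> b) \<le> L" if "b \<in> A" for b
    using member_le_sum[of b A "\<lambda>b. length (\<phi> b)"] that assms(1) by (simp add: L_def)
  show ?thesis
  proof (intro exI allI impI, elim conjE)
    fix w assume w: "word_over A w" "geqA E (eval_word \<phi> w) []"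
    let ?n = "length w + 1"
    define N where "N = L * ?n"
    have len: "length (eval_word \<phi> w) + 2 \<le> N"
      using length_eval_word[OF w(1), of \<phi> L] L by (simp add: N_def L_def)
    have filling: "aeq A R (c * length w + length (eval_word \<phi> w) * (4 * area_const * N ^ 3)) w []"
      by (rule aeq_trans[OF pushed_eval_word[OF assms(2) c w(1)] pushed_null[OF w(2) len]])
    have "c * length w + length (eval_word \<phi> w) * (4 * area_const * N ^ 3)
        \<le> c * ?n ^ 4 + N * (4 * area_const * N ^ 3)"
      using len self_le_power[of ?n 4] by (intro add_mono mult_le_mono) auto
    also have "\<dots> = (c + 4 * area_const * L ^ 4) * ?n ^ 4"
      by (simp add: N_def power_mult_distrib eval_nat_numeral algebra_simps)
    finally show "aeq A R ((c + 4 * area_const * L ^ 4) * ?n ^ 4) w []"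
      by (rule aeq_mono[OF filling])
  qed
qed

end

section \<open>The Dehn bound and a finite presentation of the kernel\<close>

lemma fin_pres_geq:
  assumes "is_fin_pres_H E A R \<phi>" "word_over A u" "word_over A v" "geqA E (eval_word \<phi> u) (eval_word \<phi> v)"
  shows "geq A R u v"
proof -
  have "word_over A w \<Longrightarrow> raag_eq E (eval_word \<phi> w) [] \<longleftrightarrow> null_word A R w" for w
    using assms(1) unfolding is_fin_pres_H_def by blast
  from this[of "u @ winv v"] have "null_word A R (u @ winv v)"
    using assms(2-4) by (simp add: raag_eq_iff_geq geq_iff_null)
  then show ?thesis using assms(2,3) by (simp add: geq_null_word_iff)
qed

text \<open>The words \<open>x a b\<close> are chosen in the given generators; their triangle laws
  hold in the Artin group and transfer by injectivity.\<close>

lemma dehn_quartic: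
  fixes E :: "'v::finite \<Rightarrow> 'v \<Rightarrow> bool"
  assumes "symp E" "irreflp E" "simply_connected (flag_realization E)" and pres: "is_fin_pres_H E A R \<phi>"
  shows "dehn_le (dehn A R) (\<lambda>n. n ^ 4)"
proof -
  have "\<exists>w. word_over A w \<and> geqA E (eval_word \<phi> w) [(a, False), (b, True)]" for a b
    using pres unfolding is_fin_pres_H_def raag_eq_iff_geq by simp
  then obtain x where x: "\<And>a b. word_over A (x a b)"
      "\<And>a b. geqA E (eval_word \<phi> (x a b)) [(a, False), (b, True)]" by metis
  interpret pushing E A R x
  proof
    fix a b c assume abc: "adj E a b" "adj E b c" "adj E a c"
    show "geq A R (x a b @ x b c) (x a c)"
      using geq_trans[OF geq_trans[OF geq_append[OF x(2) x(2)] raag_edge_mult(1)[OF assms(1) abc]] geq_sym[OF x(2)]]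
      by (intro fin_pres_geq[OF pres]) (simp_all add: x(1))
    show "geq A R (x b c @ x a b) (x a c)"
      using geq_trans[OF geq_trans[OF geq_append[OF x(2) x(2)] raag_edge_mult(2)[OF assms(1) abc]] geq_sym[OF x(2)]]
      by (intro fin_pres_geq[OF pres]) (simp_all add: x(1))
  qed (use assms x in auto)
  have fin: "finite A" and \<phi>: "\<And>b. b \<in> A \<Longrightarrow> expsum (\<phi> b) = 0"
    and null: "\<And>w. word_over A w \<Longrightarrow> null_word A R w \<Longrightarrow> geqA E (eval_word \<phi> w) []"
    using pres unfolding is_fin_pres_H_def raag_eq_iff_geq by auto
  have "geq A R [(b, False)] (pushed 0 (\<phi> b))" if "b \<in> A" for b
    by (rule fin_pres_geq[OF pres])
      (use that eval_pushed[OF x(2), of 0 "\<phi> b"] \<phi> in \<open>auto simp: eval_word_Cons intro: geq_sym\<close>)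
  from quartic_filling[OF fin \<phi> this] obtain K where
    K: "\<And>w. word_over A w \<Longrightarrow> geqA E (eval_word \<phi> w) [] \<Longrightarrow> aeq A R (K * (length w + 1) ^ 4) w []"
    by blast
  have bound: "dehn A R n \<le> K * (n + 1) ^ 4" for n
  proof -
    \<comment> \<open>Bounding a \<open>Max\<close> needs the set to be finite and nonempty; the
      empty word is a member.\<close>
    let ?W = "{w. word_over A w \<and> length w \<le> n \<and> null_word A R w}"
    have "?W \<subseteq> {w. set w \<subseteq> A \<times> UNIV \<and> length w \<le> n}"
      by (force simp: word_over_def)
    then have "finite ?W"
      by (rule finite_subset) (simp add: finite_lists_length_le fin)
    moreover have "[] \<in> ?W" by (simp add: null_word_iff_aeq aeq_refl)
    moreover have "area A R w \<le> K * (n + 1) ^ 4" if "w \<in> ?W" for w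
    proof -
      have "area A R w \<le> K * (length w + 1) ^ 4" using that by (intro area_le K null) auto
      also have "\<dots> \<le> K * (n + 1) ^ 4" using that by (intro mult_le_mono2 power_mono) auto
      finally show ?thesis .
    qed
    ultimately show ?thesis unfolding dehn_def by (subst Max_le_iff) (auto intro: exI[of _ "[]"])
  qed
  show ?thesis unfolding dehn_le_def
  proof (intro exI[of _ "K + 1"] conjI allI)
    fix n
    have "K * (n + 1) ^ 4 \<le> (K + 1) * ((K + 1) * n + (K + 1)) ^ 4"
      by (intro mult_le_mono power_mono) auto
    with bound[of n] show "dehn A R n \<le> (K + 1) * ((K + 1) * n + (K + 1)) ^ 4 + (K + 1) * n + (K + 1)"
      by linarith
  qed simp
qed

text \<open>The presentation is of Dicks-Leary type: one generator for each oriented edge, also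
  degenerate ones, and both multiplication laws for each triangle. Pushing gives surjectivity,
  \<open>quartic_filling\<close> injectivity.\<close>

lemma fin_pres_exists:
  fixes E :: "'v::finite \<Rightarrow> 'v \<Rightarrow> bool"
  assumes "symp E" "irreflp E" "simply_connected (flag_realization E)"
  shows "\<exists>(A::nat set) R \<phi>. is_fin_pres_H E A R \<phi>"
proof -
  define A where "A = to_nat ` {(a, b). adj E a b}"
  \<comment> \<open>The empty word is a default for non-adjacent pairs, so that every
    \<open>x a b\<close> is a word over \<open>A\<close>.\<close>
  define x where "x a b = (if adj E a b then [(to_nat (a, b), False)] else [])" for a b
  define R where "R = {r. \<exists>a b c. adj E a b \<and> adj E b c \<and> adj E a c \<and>
    r \<in> {x a b @ x b c @ winv (x a c), x b c @ x a b @ winv (x a c)}}"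
  define \<phi> :: "nat \<Rightarrow> 'v word" where "\<phi> n = (case from_nat n of (a, b) \<Rightarrow> [(a, False), (b, True)])" for n
  have x_over: "word_over A (x a b)" for a b by (auto simp: x_def A_def)
  have x_eval: "eval_word \<phi> (x a b) = [(a, False), (b, True)]" if "adj E a b" for a b
    using that by (simp add: x_def eval_word_Cons \<phi>_def)
  have R_over: "word_over A r" if "r \<in> R" for r using that x_over by (auto simp: R_def)
  have R_geq: "geq A R u v" if "u @ winv v \<in> R" "word_over A u" "word_over A v" for u v
    using geq_relator[OF that(1) R_over[OF that(1)]] that by (simp add: geq_iff_null)
  interpret pushing E A R x
  proof
    fix a b c assume abc: "adj E a b" "adj E b c" "adj E a c"
    show "geq A R (x a b @ x b c) (x a c)" "geq A R (x b c @ x a b) (x a c)"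
      using abc by (auto intro!: R_geq simp: x_over) (auto simp: R_def)
  qed (use assms x_over in auto)
  have \<phi>: "expsum (\<phi> b) = 0" for b by (simp add: \<phi>_def split: prod.splits)
  have finA: "finite A" unfolding A_def by simp
  have "geq A R [(n, False)] (pushed 0 (\<phi> n))" if n: "n \<in> A" for n
  proof -
    obtain a b where ab: "n = to_nat (a, b)" "adj E a b" using n by (auto simp: A_def)
    \<comment> \<open>As \<open>P v 0\<close> is empty, pushing the image of the generator gives
      \<open>winv (P a 1)\<close> followed by \<open>P b 1\<close>; the edge law at exponent 1
      identifies this with \<open>x a b\<close>.\<close>
    have "geq A R (P a 1 @ x a b) (P b 1)"
      using P_edge_aeq[OF ab(2), of 1] by (auto simp: geq_def)
    from geq_move(1)[OF this] show ?thesis using ab by (simp add: x_def \<phi>_def)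
  qed
  from quartic_filling[OF finA \<phi> this]
  have null: "null_word A R w" if "word_over A w" "geqA E (eval_word \<phi> w) []" for w
    using that null_word_iff_aeq by blast
  have surj: "geqA E (eval_word \<phi> (pushed 0 u)) u" if "expsum u = 0" for u
    using eval_pushed[of \<phi> 0 u] that by (simp add: x_eval geq_refl)
  have rel: "geqA E (eval_word \<phi> r) []" if r: "r \<in> R" for r
  proof -
    obtain a b c where abc: "adj E a b" "adj E b c" "adj E a c"
      and "r \<in> {x a b @ x b c @ winv (x a c), x b c @ x a b @ winv (x a c)}"
      using r unfolding R_def by blast
    then have "r = (x a b @ x b c) @ winv (x a c) \<or> r = (x b c @ x a b) @ winv (x a c)" by simp
    then show ?thesis
      using raag_edge_mult[OF assms(1) abc] abc by (auto simp: geq_iff_null x_eval simp del: append_assoc append_Cons)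
  qed
  have "is_fin_pres_H E A R \<phi>"
    unfolding is_fin_pres_H_def raag_eq_iff_geq
  proof (intro conjI ballI allI impI iffI)
    show "finite R"
      by (rule finite_subset[of _ "\<Union>a b c. {x a b @ x b c @ winv (x a c), x b c @ x a b @ winv (x a c)}"])
        (auto simp: R_def)
    show "\<exists>w. word_over A w \<and> geqA E (eval_word \<phi> w) u" if "expsum u = 0" for u
      using surj[OF that] over_pushed by blast
  qed (use finA \<phi> R_over null geq_eval_null[OF rel] in auto)
  then show ?thesis by blast
qed

theorem theorem1p1:
  fixes E :: "'v::finite \<Rightarrow> 'v \<Rightarrow> bool"
  assumes "symp E" and "irreflp E"
    and "simply_connected (flag_realization E)"
  shows "(\<exists>(A::nat set) R \<phi>. is_fin_pres_H E A R \<phi>) \<and>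
         (\<forall>(A::'b set) R \<phi>. is_fin_pres_H E A R \<phi> \<longrightarrow> dehn_le (dehn A R) (\<lambda>n. n ^ 4))"
  using fin_pres_exists[OF assms] dehn_quartic[OF assms] by blast

end
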